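(* Let $N\ge2$ be an integer, $\alpha<-1$ and $\sigma\in(2,-2\alpha)$. Put $$Q_{cr}:=\frac{2\left(N+\frac{2\alpha+\sigma}{2-\sigma}\right)}{N+\frac{2\alpha+\sigma}{2-\sigma}-2}.$$ Then for any real $Q$ with $Q_{cr}\le Q$ if $N=2$, or $Q_{cr}\le Q\le\frac{2N}{N-2}$ if $N\ge3$, there exists a positive constant $C=C(N,Q,\alpha,\sigma)$ such that for every $f\in C_0^\infty(\mathcal C_1)$ $$\left(\int_{\mathcal C_1}(1-|\lambda|)^\alpha|f(x',\lambda)|^{Q}\,dx'\,d\lambda\right)^{\frac2Q}\le C\int_{\mathcal C_1}(1-|\lambda|)^\alpha\left(|\nabla_{x'}f|^2+(1-|\lambda|)^\sigma|\partial_\lambda f|^2\right)dx'\,d\lambda.$$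
   Context: Points of $\mathbb R^N$ are written $(x',\lambda)\in\mathbb R^{N-1}\times\mathbb R$, and $\mathcal C_1:=\{(x',\lambda)\in\mathbb R^{N-1}\times\mathbb R:|x'|<1,\ |\lambda|<1\}$. $C_0^\infty(U)$ denotes the smooth real-valued functions with compact support in the open set $U$. $\nabla_{x'}$ is the gradient in the $x'$ variables. *)

theory Defs
  imports "HOL-Analysis.Analysis"
begin

text \<open>The points of \<open>\<real>\<^sup>N\<close> are the pairs of type \<open>(real ^ 'n) \<times> real\<close>, where the
  index type has \<open>N - 1\<close> elements. Both norms in use are the Euclidean ones.\<close>

definition C1 :: "((real ^ 'n) \<times> real) set" where
  "C1 = {(x, t). norm x < 1 \<and> \<bar>t\<bar> < 1}"

fun Ck_on :: "nat \<Rightarrow> ('a::euclidean_space \<Rightarrow> real) \<Rightarrow> 'a set \<Rightarrow> bool" where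
  "Ck_on 0 f U \<longleftrightarrow> continuous_on U f"
| "Ck_on (Suc k) f U \<longleftrightarrow>
     (\<forall>x\<in>U. f differentiable (at x)) \<and>
     (\<forall>v. Ck_on k (\<lambda>x. frechet_derivative f (at x) v) U)"

text \<open>Functions on an open set \<open>U\<close> with compact support in \<open>U\<close> are identified with their
  extensions by zero to the whole space, which are again smooth.\<close>

definition test_functions :: "'a::euclidean_space set \<Rightarrow> ('a \<Rightarrow> real) set" where
  "test_functions U = {f. (\<forall>k. Ck_on k f UNIV) \<and>
     compact (closure {x. f x \<noteq> 0}) \<and> closure {x. f x \<noteq> 0} \<subseteq> U}"

text \<open>The gradient is unspecified at points of non-differentiability.\<close>

definition gradient :: "('a::euclidean_space \<Rightarrow> real) \<Rightarrow> 'a \<Rightarrow> 'a" where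
  "gradient g x = (THE D. GDERIV g x :> D)"

lemma gradient_eqI:
  assumes "GDERIV g x :> D"
  shows "gradient g x = D"
  unfolding gradient_def
proof (rule the_equality[where P = "\<lambda>D. GDERIV g x :> D", OF assms])
  fix D' assume "GDERIV g x :> D'"
  with assms have "(\<lambda>h. h \<bullet> D') = (\<lambda>h. h \<bullet> D)"
    unfolding gderiv_def by (rule has_derivative_unique[rotated])
  then show "D' = D"
    by (metis vector_eq_ldot)
qed

definition grad_fst :: "((real ^ 'n) \<times> real \<Rightarrow> real) \<Rightarrow> (real ^ 'n) \<times> real \<Rightarrow> real ^ 'n" where
  "grad_fst f = (\<lambda>(x, t). gradient (\<lambda>y. f (y, t)) x)"

definition deriv_snd :: "((real ^ 'n) \<times> real \<Rightarrow> real) \<Rightarrow> (real ^ 'n) \<times> real \<Rightarrow> real" where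
  "deriv_snd f = (\<lambda>(x, t). deriv (\<lambda>s. f (x, s)) t)"

definition Q_cr :: "nat \<Rightarrow> real \<Rightarrow> real \<Rightarrow> real" where
  "Q_cr N \<alpha> \<sigma> =
     2 * (real N + (2 * \<alpha> + \<sigma>) / (2 - \<sigma>)) / (real N + (2 * \<alpha> + \<sigma>) / (2 - \<sigma>) - 2)"

end

theory Submission
  imports Defs
begin

text \<open>
  Write \<open>r = 1 - \<bar>\<lambda>\<bar>\<close>, \<open>\<beta> = \<alpha>/2 + \<sigma>/4 < 0\<close> and \<open>g = r\<^sup>\<beta> \<bar>f\<bar>\<close>. In the variable \<open>s\<close> with
  \<open>ds = r\<^bsup>-\<sigma>/2\<^esup> d\<lambda>\<close> the energy becomes \<open>\<integral> w (\<bar>\<nabla>\<^sub>x f\<bar>\<^sup>2 + \<bar>\<partial>\<^sub>s f\<bar>\<^sup>2) dx ds\<close> with \<open>w = r\<^bsup>2\<beta>\<^esup>\<close>, and the left-hand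
  integral becomes \<open>\<integral> w \<bar>f\<bar>\<^sup>Q dx ds\<close>. As \<open>\<sigma> > 2\<close>, the variable \<open>s\<close> runs over the whole line, so the
  problem lives on an infinite cylinder of bounded cross-section, with a weight \<open>w \<ge> 1\<close> whose
  logarithmic derivative in \<open>s\<close> is bounded.

  Three observations prove the inequality. Since \<open>w \<ge> 1\<close> and \<open>Q \<ge> 2\<close> (because \<open>Q_cr > 2\<close>), one has
  \<open>w \<bar>f\<bar>\<^sup>Q \<le> (w\<^bsup>1/2\<^esup> \<bar>f\<bar>)\<^sup>Q = g\<^sup>Q\<close>; so an unweighted Sobolev inequality for \<open>g\<close> suffices. The gradient of
  \<open>g\<close> is that of \<open>f\<close> times \<open>w\<^bsup>1/2\<^esup>\<close>, plus a term of size \<open>g\<close>. Finally \<open>f\<close> vanishes for \<open>\<bar>x\<bar> \<ge> 1\<close>, so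
  the Poincare inequality in \<open>x\<close> bounds \<open>\<integral> g\<^sup>2 dx ds\<close> by the energy (\<open>Poincare\<close>), which absorbs the extra
  term (\<open>H_bound\<close>).

  The Sobolev inequality is obtained following Gagliardo and Nirenberg. For \<open>\<gamma> > 1\<close> the function \<open>g\<^sup>\<gamma>\<close> is at
  each point at most the integral of \<open>\<gamma> g\<^bsup>\<gamma>-1\<^esup> \<bar>\<nabla>g\<bar>\<close> along every coordinate line through it
  (\<open>line_bound_fst\<close>, \<open>line_bound_snd\<close>); the inequality \<open>nn_integral_Gagliardo\<close> for products of line
  integrals followed by the Cauchy-Schwarz inequality then gives \<open>Sobolev_step\<close>:
  \<open>(\<integral> g\<^bsup>\<gamma>N/(N-1)\<^esup>)\<^bsup>2(N-1)/N\<^esup> \<le> \<gamma>\<^sup>2 \<cdot> const \<cdot> energy \<cdot> \<integral> g\<^bsup>2(\<gamma>-1)\<^esup>\<close>. For \<open>N \<ge> 3\<close> a single \<open>\<gamma>\<close> makes both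
  exponents equal to \<open>2N/(N-2)\<close>; for \<open>N = 2\<close> the exponents \<open>2, 4, 6, \<dots>\<close> are reached one after the other.
  Every \<open>Q\<close> in between follows by interpolating with the exponent \<open>2\<close>.

  The change of variable is never carried out: all integrals are with respect to \<open>dx d\<lambda>\<close>, and the factor
  \<open>r\<^bsup>-\<sigma>/2\<^esup>\<close>, which is constant along the lines in the \<open>x\<close> directions, is carried along.
\<close>

section \<open>Powers of extended nonnegative reals and Hoelder's inequality for products\<close>

lemma prod_mono_ennreal:
  fixes f g :: "'i \<Rightarrow> ennreal"
  shows "(\<And>i. i \<in> A \<Longrightarrow> f i \<le> g i) \<Longrightarrow> prod f A \<le> prod g A"
  by (induction A rule: infinite_finite_induct) (auto intro: mult_mono)

text \<open>Real powers on \<open>[0, \<infinity>]\<close> for nonnegative exponents. With \<open>x\<^sup>0 = 1\<close> for every \<open>x\<close>, unlike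
  for \<open>powr\<close>, the exponent law \<open>epow_add\<close> and Hoelder's inequality also hold for vanishing exponents; in
  \<open>nn_integral_Gagliardo\<close> such an exponent occurs.\<close>
definition epow :: "ennreal \<Rightarrow> real \<Rightarrow> ennreal" where
  "epow x p = (if p = 0 then 1 else if x = \<infinity> then \<infinity> else ennreal (enn2real x powr p))"

lemma epow_0 [simp]: "epow x 0 = 1"
  by (simp add: epow_def)

lemma epow_ennreal: "0 \<le> a \<Longrightarrow> p \<noteq> 0 \<Longrightarrow> epow (ennreal a) p = ennreal (a powr p)"
  by (simp add: epow_def)

lemma epow_top: "p \<noteq> 0 \<Longrightarrow> epow \<infinity> p = \<infinity>"
  by (simp add: epow_def)

lemma epow_eq_0_iff: "p \<noteq> 0 \<Longrightarrow> epow x p = 0 \<longleftrightarrow> x = 0"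
  by (cases x) (auto simp: epow_def)

lemma epow_mono: "x \<le> y \<Longrightarrow> 0 \<le> p \<Longrightarrow> epow x p \<le> epow y p"
  by (cases x; cases y) (auto simp: epow_def top_unique intro!: powr_mono2 ennreal_leI)

lemma epow_mult: "0 \<le> p \<Longrightarrow> epow (x * y) p = epow x p * epow y p"
  by (cases x; cases y)
     (auto simp: epow_def ennreal_mult[symmetric] powr_mult ennreal_mult_eq_top_iff enn2real_mult
        ennreal_top_mult ennreal_mult_top)

lemma epow_add: "0 \<le> p \<Longrightarrow> 0 \<le> q \<Longrightarrow> epow x (p + q) = epow x p * epow x q"
  by (cases x) (auto simp: epow_def powr_add ennreal_mult[symmetric] add_nonneg_eq_0_iff)

lemma epow_prod: "0 \<le> p \<Longrightarrow> epow (\<Prod>j\<in>J. f j) p = (\<Prod>j\<in>J. epow (f j) p)"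
  by (induction J rule: infinite_finite_induct) (auto simp: epow_mult epow_def[of 1])

lemma epow_measurable [measurable (raw)]:
  assumes [measurable]: "f \<in> borel_measurable M"
  shows "(\<lambda>x. epow (f x) p) \<in> borel_measurable M"
  unfolding epow_def by measurable

text \<open>Convexity of the exponential function, applied to the logarithms.\<close>
lemma weighted_arith_geom_mean:
  fixes x p :: "'i \<Rightarrow> real"
  assumes fin: "finite J" and "\<And>j. j \<in> J \<Longrightarrow> 0 \<le> x j" and "\<And>j. j \<in> J \<Longrightarrow> 0 \<le> p j"
    and "sum p J = 1"
  shows "(\<Prod>j\<in>J. x j powr p j) \<le> (\<Sum>j\<in>J. p j * x j)"
proof (cases "\<exists>j\<in>J. x j = 0")
  case True
  then have "(\<Prod>j\<in>J. x j powr p j) = 0"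
    using fin by (auto simp: prod_zero_iff)
  moreover have "0 \<le> (\<Sum>j\<in>J. p j * x j)"
    using assms by (simp add: sum_nonneg)
  ultimately show ?thesis
    by linarith
next
  case False
  then have pos: "\<And>j. j \<in> J \<Longrightarrow> 0 < x j"
    using assms by force
  have "J \<noteq> {}"
    using assms by auto
  have "(\<Prod>j\<in>J. x j powr p j) = exp (\<Sum>j\<in>J. p j * ln (x j))"
    using fin pos by (simp add: exp_sum powr_def cong: prod.cong)
      (intro prod.cong refl, force)
  also have "\<dots> \<le> (\<Sum>j\<in>J. p j * exp (ln (x j)))"
    using convex_on_sum[OF fin \<open>J \<noteq> {}\<close> exp_convex assms(4), of "\<lambda>j. ln (x j)"] assms(3)
    by simp
  also have "\<dots> = (\<Sum>j\<in>J. p j * x j)"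
    using pos by (intro sum.cong) auto
  finally show ?thesis .
qed

text \<open>The weighted arithmetic-geometric mean inequality for the quotients \<open>f j / c j\<close>. In Hoelder's
  inequality \<open>c j\<close> is the integral of \<open>f j\<close>, so that the right-hand side integrates to the product of the
  powers of the \<open>c j\<close>.\<close>
lemma weighted_arith_geom_mean_epow:
  fixes f c :: "'i \<Rightarrow> ennreal"
  assumes fin: "finite J" and p: "\<And>j. j \<in> J \<Longrightarrow> 0 < p j" "sum p J = 1"
    and c: "\<And>j. j \<in> J \<Longrightarrow> c j \<noteq> 0" "\<And>j. j \<in> J \<Longrightarrow> c j \<noteq> \<infinity>"
  shows "(\<Prod>j\<in>J. epow (f j) (p j)) \<le>
    (\<Prod>j\<in>J. epow (c j) (p j)) * (\<Sum>j\<in>J. ennreal (p j) / c j * f j)"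
proof (cases "\<exists>j\<in>J. f j = \<infinity>")
  case True
  then obtain i where i: "i \<in> J" "f i = \<infinity>" by auto
  have "ennreal (p i) / c i \<noteq> 0"
    using p(1)[OF i(1)] c[OF i(1)] by (simp add: ennreal_divide_eq_0_iff)
  then have "ennreal (p i) / c i * f i = \<infinity>"
    using i by (simp add: ennreal_mult_eq_top_iff)
  moreover have "ennreal (p i) / c i * f i \<le> (\<Sum>j\<in>J. ennreal (p j) / c j * f j)"
    using fin i by (intro member_le_sum) auto
  ultimately have "(\<Sum>j\<in>J. ennreal (p j) / c j * f j) = \<infinity>"
    by (simp add: top_unique)
  moreover have "(\<Prod>j\<in>J. epow (c j) (p j)) \<noteq> 0"
    using fin c p by (auto simp: prod_zero_iff epow_eq_0_iff less_imp_neq[symmetric])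
  ultimately have "(\<Prod>j\<in>J. epow (c j) (p j)) * (\<Sum>j\<in>J. ennreal (p j) / c j * f j) = \<infinity>"
    by (metis ennreal_mult_top infinity_ennreal_def)
  then show ?thesis
    by simp
next
  case False
  define f' where "f' j = enn2real (f j)" for j
  define c' where "c' j = enn2real (c j)" for j
  have f: "f j = ennreal (f' j)" if "j \<in> J" for j
    using False that by (auto simp: f'_def less_top)
  have c'': "c j = ennreal (c' j)" if "j \<in> J" for j
    using c(2) that by (auto simp: c'_def less_top)
  have c'pos: "0 < c' j" if "j \<in> J" for j
    using c'' that c(1)[OF that] by (metis c'_def enn2real_nonneg ennreal_0 less_eq_real_def)
  have f'nn: "0 \<le> f' j" for j by (simp add: f'_def)
  have "(\<Prod>j\<in>J. f' j powr p j) = (\<Prod>j\<in>J. c' j powr p j) * (\<Prod>j\<in>J. (f' j / c' j) powr p j)"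
    unfolding prod.distrib[symmetric]
  proof (intro prod.cong refl)
    fix j assume "j \<in> J"
    with c'pos[of j] f'nn[of j] show "f' j powr p j = c' j powr p j * (f' j / c' j) powr p j"
      by (simp add: powr_mult[symmetric])
  qed
  also have "\<dots> \<le> (\<Prod>j\<in>J. c' j powr p j) * (\<Sum>j\<in>J. p j * (f' j / c' j))"
    using fin p c'pos f'nn
    by (intro mult_left_mono weighted_arith_geom_mean prod_nonneg)
       (auto simp: less_imp_le)
  finally have main: "(\<Prod>j\<in>J. f' j powr p j) \<le>
    (\<Prod>j\<in>J. c' j powr p j) * (\<Sum>j\<in>J. p j * (f' j / c' j))" .
  have "(\<Prod>j\<in>J. epow (f j) (p j)) = ennreal (\<Prod>j\<in>J. f' j powr p j)"
    by (subst prod_ennreal[symmetric])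
       (auto intro!: prod.cong simp: f f'nn epow_ennreal dest!: p(1))
  moreover have "(\<Prod>j\<in>J. epow (c j) (p j)) = ennreal (\<Prod>j\<in>J. c' j powr p j)"
    by (subst prod_ennreal[symmetric])
       (auto intro!: prod.cong epow_ennreal simp: c'' c'pos less_imp_le dest: p(1))
  moreover have "(\<Sum>j\<in>J. ennreal (p j) / c j * f j) = ennreal (\<Sum>j\<in>J. p j * (f' j / c' j))"
  proof (subst sum_ennreal[symmetric])
    fix j assume j: "j \<in> J"
    show "0 \<le> p j * (f' j / c' j)"
      using p(1)[OF j] f'nn[of j] c'pos[OF j] by simp
  next
    show "(\<Sum>j\<in>J. ennreal (p j) / c j * f j) = (\<Sum>j\<in>J. ennreal (p j * (f' j / c' j)))"
    proof (intro sum.cong refl)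
      fix j assume j: "j \<in> J"
      show "ennreal (p j) / c j * f j = ennreal (p j * (f' j / c' j))"
        using p(1)[OF j] f'nn[of j] c'pos[OF j]
        by (simp add: f[OF j] c''[OF j] divide_ennreal ennreal_mult[symmetric])
    qed
  qed
  ultimately show ?thesis
    using main by (simp add: ennreal_mult'[symmetric] prod_nonneg ennreal_leI)
qed

text \<open>Hoelder's inequality for finitely many functions, by normalising each one to integral 1. Factors
  with exponent \<open>0\<close> are dropped first; if some remaining integral is \<open>0\<close> or \<open>\<infinity>\<close>, the claim is
  immediate.\<close>
lemma nn_integral_Hoelder_prod:
  fixes f :: "'i \<Rightarrow> 'a \<Rightarrow> ennreal"
  assumes fin: "finite J" and meas [measurable]: "\<And>j. j \<in> J \<Longrightarrow> f j \<in> borel_measurable M"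
    and p: "\<And>j. j \<in> J \<Longrightarrow> 0 \<le> p j" "sum p J = 1"
  shows "(\<integral>\<^sup>+x. (\<Prod>j\<in>J. epow (f j x) (p j)) \<partial>M) \<le> (\<Prod>j\<in>J. epow (\<integral>\<^sup>+x. f j x \<partial>M) (p j))"
proof -
  define K where "K = {j\<in>J. p j \<noteq> 0}"
  define c where "c j = (\<integral>\<^sup>+x. f j x \<partial>M)" for j
  have K: "finite K" "K \<subseteq> J" "\<And>j. j \<in> K \<Longrightarrow> 0 < p j"
    using fin p by (auto simp: K_def less_eq_real_def)
  have sumK: "sum p K = 1"
    unfolding p(2)[symmetric] by (intro sum.mono_neutral_left) (auto simp: K_def fin)
  have toK: "(\<Prod>j\<in>J. epow (g j) (p j)) = (\<Prod>j\<in>K. epow (g j) (p j))" for g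
    by (intro prod.mono_neutral_right) (auto simp: K_def fin)
  have measK [measurable]: "\<And>j. j \<in> K \<Longrightarrow> f j \<in> borel_measurable M"
    using K(2) meas by auto
  have "(\<integral>\<^sup>+x. (\<Prod>j\<in>K. epow (f j x) (p j)) \<partial>M) \<le> (\<Prod>j\<in>K. epow (c j) (p j))"
  proof (cases "\<exists>i\<in>K. c i = 0")
    case True
    then obtain i where i: "i \<in> K" "c i = 0" by auto
    then have "AE x in M. f i x = 0"
      unfolding c_def by (subst (asm) nn_integral_0_iff_AE) auto
    then have "AE x in M. (\<Prod>j\<in>K. epow (f j x) (p j)) = 0"
      by eventually_elim (use i K in \<open>force simp: prod_zero_iff epow_eq_0_iff\<close>)
    then have "(\<integral>\<^sup>+x. (\<Prod>j\<in>K. epow (f j x) (p j)) \<partial>M) = 0"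
      by (subst nn_integral_0_iff_AE) auto
    then show ?thesis by simp
  next
    case c0: False
    show ?thesis
    proof (cases "\<exists>i\<in>K. c i = \<infinity>")
      case True
      then obtain i where i: "i \<in> K" "c i = \<infinity>" by auto
      have "(\<Prod>j\<in>K. epow (c j) (p j)) = epow (c i) (p i) * (\<Prod>j\<in>K - {i}. epow (c j) (p j))"
        using K i by (simp add: prod.remove)
      moreover have "(\<Prod>j\<in>K - {i}. epow (c j) (p j)) \<noteq> 0"
        using c0 K by (auto simp: prod_zero_iff epow_eq_0_iff less_imp_neq[symmetric])
      ultimately have "(\<Prod>j\<in>K. epow (c j) (p j)) = \<infinity>"
        using i K(3)[OF i(1)]
        by (metis ennreal_top_mult epow_top infinity_ennreal_def less_irrefl)
      then show ?thesis by simp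
    next
      case False
      have "(\<integral>\<^sup>+x. (\<Prod>j\<in>K. epow (f j x) (p j)) \<partial>M) \<le>
        (\<integral>\<^sup>+x. (\<Prod>j\<in>K. epow (c j) (p j)) * (\<Sum>j\<in>K. ennreal (p j) / c j * f j x) \<partial>M)"
        using K sumK c0 False
        by (intro nn_integral_mono weighted_arith_geom_mean_epow) auto
      also have "\<dots> = (\<Prod>j\<in>K. epow (c j) (p j)) * (\<Sum>j\<in>K. ennreal (p j) / c j * c j)"
        by (simp add: nn_integral_cmult nn_integral_sum c_def)
      also have "(\<Sum>j\<in>K. ennreal (p j) / c j * c j) = (\<Sum>j\<in>K. ennreal (p j))"
        using c0 False
        by (intro sum.cong) (auto simp: ennreal_divide_times ennreal_divide_self less_top)
      also have "\<dots> = 1"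
        using K sumK by (simp add: sum_ennreal less_imp_le)
      finally show ?thesis by simp
    qed
  qed
  then show ?thesis
    by (simp add: toK c_def)
qed

section \<open>The Gagliardo inequality for line integrals\<close>

text \<open>A form of the Loomis-Whitney inequality that can be proved by induction on the set of
  coordinates: integrating in one new coordinate \<open>i\<close> and applying Hoelder's inequality with exponents
  \<open>1 - m p, p, \<dots>, p\<close> reproduces the same statement for \<open>\<integral> f dx\<^sub>i\<close> in place of \<open>f\<close>, on the
  remaining \<open>m\<close> coordinates. The power of \<open>f\<close> in front of the product is what makes the exponents sum to 1.\<close>
lemma (in product_sigma_finite) nn_integral_grid_lines:
  assumes "finite I" and "f \<in> borel_measurable (Pi\<^sub>M I M)"
    and "0 \<le> p" and "(real (card I) - 1) * p \<le> 1"
  shows "(\<integral>\<^sup>+x. epow (f x) (1 - (real (card I) - 1) * p)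
            * (\<Prod>i\<in>I. epow (\<integral>\<^sup>+y. f (x(i := y)) \<partial>M i) p) \<partial>Pi\<^sub>M I M)
       \<le> epow (\<integral>\<^sup>+x. f x \<partial>Pi\<^sub>M I M) (1 + p)"
  using assms
proof (induction I arbitrary: f rule: finite_induct)
  case empty
  then show ?case by (simp add: nn_integral_empty)
next
  case (insert i I)
  note [measurable] = insert.prems(1)
  define m where "m = real (card I)"
  have card: "real (card (insert i I)) - 1 = m"
    using insert by (simp add: m_def)
  have m0: "0 \<le> m" by (simp add: m_def)
  have mp: "m * p \<le> 1" and mp': "(m - 1) * p \<le> 1"
    using insert.prems card m0 by (auto simp: algebra_simps)
  define B where "B x = (\<integral>\<^sup>+y. f (x(i := y)) \<partial>M i)" for x
  have B [measurable]: "B \<in> borel_measurable (Pi\<^sub>M I M)"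
    unfolding B_def by (intro sigma_finite_measure.borel_measurable_nn_integral)
     (auto simp: sigma_finite_measures)
  have slice: "(\<integral>\<^sup>+y. epow (f (x(i := y))) (1 - m * p)
            * (\<Prod>j\<in>insert i I. epow (\<integral>\<^sup>+z. f ((x(i := y))(j := z)) \<partial>M j) p) \<partial>M i)
      \<le> epow (B x) (1 - (m - 1) * p) * (\<Prod>j\<in>I. epow (\<integral>\<^sup>+z. B (x(j := z)) \<partial>M j) p)"
    if x: "x \<in> space (Pi\<^sub>M I M)" for x
  proof -
    have upd2: "(\<lambda>(y, z). f (x(i := y, j := z))) \<in> borel_measurable (M i \<Otimes>\<^sub>M M j)" if "j \<in> I" for j
    proof -
      have "(\<lambda>w. x(i := fst w)) \<in> measurable (M i \<Otimes>\<^sub>M M j) (Pi\<^sub>M (insert i I) M)"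
        by (rule measurable_fun_upd[where J=I]) (use x in auto)
      then have "(\<lambda>w. x(i := fst w, j := snd w)) \<in> measurable (M i \<Otimes>\<^sub>M M j) (Pi\<^sub>M (insert i I) M)"
        by (rule measurable_fun_upd[where J="insert i I", rotated]) (use that in auto)
      from measurable_compose[OF this insert.prems(1)] show ?thesis
        by (simp add: case_prod_beta' fun_upd_def)
    qed
    have upd1 [measurable]: "(\<lambda>y. f (x(i := y))) \<in> borel_measurable (M i)"
    proof -
      have "(\<lambda>y. x(i := y)) \<in> measurable (M i) (Pi\<^sub>M (insert i I) M)"
        by (rule measurable_fun_upd[where J=I]) (use x in auto)
      from measurable_compose[OF this insert.prems(1)] show ?thesis .
    qed
    \<comment> \<open>The factors of the slice integral, all indexed by \<open>insert i I\<close>: the slot \<open>i\<close> holds \<open>f\<close> itself,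
      because its own line integral is \<open>B x\<close>, constant along the slice.\<close>
    define A where "A j y = (if j = i then f (x(i := y)) else \<integral>\<^sup>+z. f (x(i := y, j := z)) \<partial>M j)" for j y
    define w where "w j = (if j = i then 1 - m * p else p)" for j
    have A [measurable]: "A j \<in> borel_measurable (M i)" if "j \<in> insert i I" for j
    proof (cases "j = i")
      case False
      with that have "(\<lambda>y. \<integral>\<^sup>+z. f (x(i := y, j := z)) \<partial>M j) \<in> borel_measurable (M i)"
        by (intro sigma_finite_measure.borel_measurable_nn_integral sigma_finite_measures upd2) auto
      with False show ?thesis by (simp add: A_def[abs_def])
    qed (simp add: A_def[abs_def])
    have intA: "(\<integral>\<^sup>+y. A j y \<partial>M i) = (\<integral>\<^sup>+z. B (x(j := z)) \<partial>M j)" if "j \<in> I" for j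
    proof -
      interpret pair_sigma_finite "M i" "M j"
        by (simp add: pair_sigma_finite_def sigma_finite_measures)
      have ij: "j \<noteq> i" using that insert.hyps by auto
      have "(\<integral>\<^sup>+y. A j y \<partial>M i) = (\<integral>\<^sup>+y. \<integral>\<^sup>+z. f (x(i := y, j := z)) \<partial>M j \<partial>M i)"
        using ij by (simp add: A_def)
      also have "\<dots> = (\<integral>\<^sup>+z. \<integral>\<^sup>+y. f (x(i := y, j := z)) \<partial>M i \<partial>M j)"
        by (rule Fubini'[symmetric]) (rule upd2[OF that])
      also have "\<dots> = (\<integral>\<^sup>+z. B (x(j := z)) \<partial>M j)"
        using ij by (simp add: B_def fun_upd_twist)
      finally show ?thesis .
    qed
    have prodeq: "(\<Prod>j\<in>insert i I. epow (A j y) (w j)) = epow (f (x(i := y))) (1 - m * p)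
        * (\<Prod>j\<in>I. epow (\<integral>\<^sup>+z. f (x(i := y, j := z)) \<partial>M j) p)" for y
    proof -
      have "(\<Prod>j\<in>I. epow (A j y) (w j)) = (\<Prod>j\<in>I. epow (\<integral>\<^sup>+z. f (x(i := y, j := z)) \<partial>M j) p)"
        using insert.hyps by (intro prod.cong) (auto simp: A_def w_def)
      then show ?thesis
        using insert.hyps by (simp add: A_def w_def)
    qed
    have "sum w (insert i I) = 1"
    proof -
      have "sum w I = (\<Sum>j\<in>I. p)"
        using insert.hyps by (intro sum.cong) (auto simp: w_def)
      then show ?thesis using insert.hyps by (simp add: w_def m_def)
    qed
    then have holder: "(\<integral>\<^sup>+y. (\<Prod>j\<in>insert i I. epow (A j y) (w j)) \<partial>M i)
        \<le> (\<Prod>j\<in>insert i I. epow (\<integral>\<^sup>+y. A j y \<partial>M i) (w j))"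
      using insert mp by (intro nn_integral_Hoelder_prod) (auto simp: w_def)
    have "(\<Prod>j\<in>I. epow (\<integral>\<^sup>+y. A j y \<partial>M i) (w j)) = (\<Prod>j\<in>I. epow (\<integral>\<^sup>+z. B (x(j := z)) \<partial>M j) p)"
      using insert.hyps by (intro prod.cong) (auto simp: intA w_def)
    moreover have "(\<integral>\<^sup>+y. A i y \<partial>M i) = B x"
      by (simp add: A_def B_def)
    ultimately have rhs: "(\<Prod>j\<in>insert i I. epow (\<integral>\<^sup>+y. A j y \<partial>M i) (w j))
        = epow (B x) (1 - m * p) * (\<Prod>j\<in>I. epow (\<integral>\<^sup>+z. B (x(j := z)) \<partial>M j) p)"
      using insert.hyps by (simp add: w_def)
    have "(\<integral>\<^sup>+y. epow (f (x(i := y))) (1 - m * p)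
            * (\<Prod>j\<in>insert i I. epow (\<integral>\<^sup>+z. f ((x(i := y))(j := z)) \<partial>M j) p) \<partial>M i)
        = (\<integral>\<^sup>+y. epow (B x) p * (\<Prod>j\<in>insert i I. epow (A j y) (w j)) \<partial>M i)"
      unfolding prodeq using insert.hyps
      by (intro nn_integral_cong) (simp add: B_def mult_ac)
    also have "\<dots> = epow (B x) p * (\<integral>\<^sup>+y. (\<Prod>j\<in>insert i I. epow (A j y) (w j)) \<partial>M i)"
      by (intro nn_integral_cmult) measurable
    also have "\<dots> \<le> epow (B x) p * (epow (B x) (1 - m * p) * (\<Prod>j\<in>I. epow (\<integral>\<^sup>+z. B (x(j := z)) \<partial>M j) p))"
      using holder unfolding rhs by (intro mult_left_mono) auto
    also have "\<dots> = epow (B x) (p + (1 - m * p)) * (\<Prod>j\<in>I. epow (\<integral>\<^sup>+z. B (x(j := z)) \<partial>M j) p)"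
      using insert.prems mp by (subst epow_add) (auto simp: mult_ac)
    also have "p + (1 - m * p) = 1 - (m - 1) * p"
      by (simp add: algebra_simps)
    finally show ?thesis .
  qed
  have [measurable]: "(\<lambda>x. \<integral>\<^sup>+z. f (x(j := z)) \<partial>M j) \<in> borel_measurable (Pi\<^sub>M (insert i I) M)"
    if "j \<in> insert i I" for j
  proof -
    have "(\<lambda>w. (fst w)(j := snd w)) \<in> measurable (Pi\<^sub>M (insert i I) M \<Otimes>\<^sub>M M j) (Pi\<^sub>M (insert i I) M)"
      by (rule measurable_fun_upd[where J="insert i I"]) (use that in auto)
    from measurable_compose[OF this insert.prems(1)]
    show ?thesis
      by (intro sigma_finite_measure.borel_measurable_nn_integral sigma_finite_measures)
         (simp add: case_prod_beta' fun_upd_def)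
  qed
  have "(\<integral>\<^sup>+x. epow (f x) (1 - m * p)
            * (\<Prod>j\<in>insert i I. epow (\<integral>\<^sup>+z. f (x(j := z)) \<partial>M j) p) \<partial>Pi\<^sub>M (insert i I) M)
     = (\<integral>\<^sup>+x. \<integral>\<^sup>+y. epow (f (x(i := y))) (1 - m * p)
            * (\<Prod>j\<in>insert i I. epow (\<integral>\<^sup>+z. f ((x(i := y))(j := z)) \<partial>M j) p) \<partial>M i \<partial>Pi\<^sub>M I M)"
    using insert.hyps by (intro product_nn_integral_insert) measurable
  also have "\<dots> \<le> (\<integral>\<^sup>+x. epow (B x) (1 - (m - 1) * p)
      * (\<Prod>j\<in>I. epow (\<integral>\<^sup>+z. B (x(j := z)) \<partial>M j) p) \<partial>Pi\<^sub>M I M)"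
    by (intro nn_integral_mono slice) auto
  also have "\<dots> \<le> epow (\<integral>\<^sup>+x. B x \<partial>Pi\<^sub>M I M) (1 + p)"
    using insert.IH[OF B insert.prems(2)] mp' unfolding m_def by blast
  also have "(\<integral>\<^sup>+x. B x \<partial>Pi\<^sub>M I M) = (\<integral>\<^sup>+x. f x \<partial>Pi\<^sub>M (insert i I) M)"
    unfolding B_def using insert.hyps by (intro product_nn_integral_insert[symmetric]) auto
  finally show ?case
    by (simp add: card)
qed

text \<open>The case \<open>p = 1/(N - 1)\<close> of the previous lemma, where the power of \<open>F\<close> itself disappears, in the
  Euclidean space of dimension \<open>N\<close>. The inner integral runs over the line through \<open>x\<close> in
  direction \<open>b\<close>.\<close>
theorem nn_integral_Gagliardo:
  fixes F :: "'a::euclidean_space \<Rightarrow> ennreal"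
  assumes F [measurable]: "F \<in> borel_measurable borel" and dim: "2 \<le> DIM('a)"
  shows "(\<integral>\<^sup>+x. (\<Prod>b\<in>Basis. epow (\<integral>\<^sup>+y. F (x + (y - x \<bullet> b) *\<^sub>R b) \<partial>lborel)
            (1 / (real DIM('a) - 1))) \<partial>lborel)
       \<le> epow (\<integral>\<^sup>+x. F x \<partial>lborel) (real DIM('a) / (real DIM('a) - 1))"
proof -
  interpret product_sigma_finite "\<lambda>_::'a. lborel :: real measure"
    by standard
  define S where "S f = (\<Sum>b\<in>Basis. f b *\<^sub>R b)" for f :: "'a \<Rightarrow> real"
  define p where "p = 1 / (real DIM('a) - 1)"
  have S [measurable]: "S \<in> measurable (Pi\<^sub>M Basis (\<lambda>_. lborel)) borel"
    unfolding S_def by measurable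
  have int_S: "(\<integral>\<^sup>+x. g x \<partial>lborel) = (\<integral>\<^sup>+f. g (S f) \<partial>Pi\<^sub>M Basis (\<lambda>_. lborel))"
    if [measurable]: "g \<in> borel_measurable borel" for g
    by (subst lborel_eq) (simp add: nn_integral_distr S_def[symmetric])
  have S_upd: "S (x(b := y)) = S x + (y - S x \<bullet> b) *\<^sub>R b" if "b \<in> Basis" for x b y
  proof -
    have "S x \<bullet> b = x b"
      using that by (simp add: S_def)
    moreover have "S (x(b := y)) = y *\<^sub>R b + (\<Sum>c\<in>Basis - {b}. x c *\<^sub>R c)"
      unfolding S_def using that by (subst sum.remove[of _ b]) (auto intro!: sum.cong)
    moreover have "S x = x b *\<^sub>R b + (\<Sum>c\<in>Basis - {b}. x c *\<^sub>R c)"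
      unfolding S_def using that by (subst sum.remove[of _ b]) auto
    ultimately show ?thesis
      by (simp add: algebra_simps)
  qed
  have card1: "(real DIM('a) - 1) * p = 1" and p0: "0 \<le> p"
    using dim by (auto simp: p_def)
  have [measurable]: "(\<lambda>x. \<integral>\<^sup>+y. F (x + (y - x \<bullet> b) *\<^sub>R b) \<partial>lborel) \<in> borel_measurable borel" for b
    by measurable
  have "(\<integral>\<^sup>+x. (\<Prod>b\<in>Basis. epow (\<integral>\<^sup>+y. F (x + (y - x \<bullet> b) *\<^sub>R b) \<partial>lborel) p) \<partial>lborel)
     = (\<integral>\<^sup>+x. (\<Prod>b\<in>Basis. epow (\<integral>\<^sup>+y. F (S x + (y - S x \<bullet> b) *\<^sub>R b) \<partial>lborel) p)
          \<partial>Pi\<^sub>M Basis (\<lambda>_. lborel))"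
    by (rule int_S) measurable
  also have "\<dots> = (\<integral>\<^sup>+x. epow (F (S x)) (1 - (real DIM('a) - 1) * p)
       * (\<Prod>b\<in>Basis. epow (\<integral>\<^sup>+y. F (S (x(b := y))) \<partial>lborel) p) \<partial>Pi\<^sub>M Basis (\<lambda>_. lborel))"
    by (intro nn_integral_cong) (simp add: card1 S_upd cong: prod.cong)
  also have "\<dots> \<le> epow (\<integral>\<^sup>+x. F (S x) \<partial>Pi\<^sub>M Basis (\<lambda>_. lborel)) (1 + p)"
    using nn_integral_grid_lines[of Basis "\<lambda>x. F (S x)" p] card1 p0 by simp
  also have "\<dots> = epow (\<integral>\<^sup>+x. F x \<partial>lborel) (1 + p)"
    by (simp add: int_S)
  also have "1 + p = real DIM('a) / (real DIM('a) - 1)"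
    using dim by (simp add: p_def field_simps)
  finally show ?thesis
    by (simp add: p_def)
qed

text \<open>The line integral is constant along the direction \<open>b\<close>, so integrating it over the strip multiplies
  the integral of \<open>F\<close> by the width of the strip.\<close>
lemma nn_integral_strip:
  fixes F :: "'a::euclidean_space \<Rightarrow> ennreal"
  assumes F [measurable]: "F \<in> borel_measurable borel" and b: "norm b = 1"
  shows "(\<integral>\<^sup>+x. indicator {-1..1} (x \<bullet> b) * (\<integral>\<^sup>+y. F (x + (y - x \<bullet> b) *\<^sub>R b) \<partial>lborel) \<partial>lborel)
       = 2 * (\<integral>\<^sup>+x. F x \<partial>lborel)"
proof -
  have shift: "(\<integral>\<^sup>+y. F (x + (y - x \<bullet> b) *\<^sub>R b) \<partial>lborel) = (\<integral>\<^sup>+y. F (x + y *\<^sub>R b) \<partial>lborel)" for x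
    by (subst nn_integral_real_affine[where c=1 and t="x \<bullet> b"]) auto
  have trans: "(\<integral>\<^sup>+x. indicator {-1..1} (x \<bullet> b) * F (x + y *\<^sub>R b) \<partial>lborel)
      = (\<integral>\<^sup>+x. indicator {-1..1} (x \<bullet> b - y) * F x \<partial>lborel)" for y :: real
  proof -
    have "b \<bullet> b = 1"
      using b by (simp add: dot_square_norm)
    then have "(\<integral>\<^sup>+x. indicator {-1..1} (x \<bullet> b - y) * F x \<partial>distr lborel borel ((+) (y *\<^sub>R b)))
        = (\<integral>\<^sup>+x. indicator {-1..1} (x \<bullet> b) * F (x + y *\<^sub>R b) \<partial>lborel)"
      by (subst nn_integral_distr) (auto simp: inner_add_left add.commute)
    then show ?thesis
      by (simp add: lborel_distr_plus)
  qed
  have "(\<integral>\<^sup>+x. indicator {-1..1} (x \<bullet> b) * (\<integral>\<^sup>+y. F (x + (y - x \<bullet> b) *\<^sub>R b) \<partial>lborel) \<partial>lborel)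
      = (\<integral>\<^sup>+x. \<integral>\<^sup>+y. indicator {-1..1} (x \<bullet> b) * F (x + y *\<^sub>R b) \<partial>lborel \<partial>lborel)"
    by (simp add: shift nn_integral_cmult)
  also have "\<dots> = (\<integral>\<^sup>+y. \<integral>\<^sup>+x. indicator {-1..1} (x \<bullet> b) * F (x + y *\<^sub>R b) \<partial>lborel \<partial>lborel)"
    by (rule lborel_pair.Fubini') measurable
  also have "\<dots> = (\<integral>\<^sup>+y. \<integral>\<^sup>+x. indicator {-1..1} (x \<bullet> b - y) * F x \<partial>lborel \<partial>lborel)"
    by (simp add: trans)
  also have "\<dots> = (\<integral>\<^sup>+x. \<integral>\<^sup>+y. indicator {-1..1} (x \<bullet> b - y) * F x \<partial>lborel \<partial>lborel)"
    by (rule lborel_pair.Fubini'[symmetric]) measurable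
  also have "\<dots> = (\<integral>\<^sup>+x. 2 * F x \<partial>lborel)"
  proof (intro nn_integral_cong)
    fix x
    have "(\<integral>\<^sup>+y. indicator {-1..1} (x \<bullet> b - y) * F x \<partial>lborel)
        = (\<integral>\<^sup>+y. indicator {x \<bullet> b - 1..x \<bullet> b + 1} y * F x \<partial>lborel)"
      by (intro nn_integral_cong) (auto simp: indicator_def)
    also have "\<dots> = 2 * F x"
      by (simp add: nn_integral_multc)
    finally show "(\<integral>\<^sup>+y. indicator {-1..1} (x \<bullet> b - y) * F x \<partial>lborel) = 2 * F x" .
  qed
  also have "\<dots> = 2 * (\<integral>\<^sup>+x. F x \<partial>lborel)"
    by (simp add: nn_integral_cmult)
  finally show ?thesis .
qed

section \<open>One-dimensional calculus\<close>

text \<open>The finite exceptional set admits the kink of \<open>1 - \<bar>\<lambda>\<bar>\<close> at \<open>\<lambda> = 0\<close>.\<close>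
lemma increment_le_nn_integral:
  fixes h h' k :: "real \<Rightarrow> real"
  assumes S: "finite S" and ab: "a \<le> b" and cont: "continuous_on {a..b} h"
    and der: "\<And>s. s \<in> {a<..<b} - S \<Longrightarrow> (h has_real_derivative h' s) (at s)"
    and bound: "\<And>s. s \<in> {a<..<b} - S \<Longrightarrow> \<bar>h' s\<bar> \<le> k s"
    and k: "k \<in> borel_measurable borel" "\<And>s. 0 \<le> k s"
  shows "ennreal \<bar>h b - h a\<bar> \<le> (\<integral>\<^sup>+s. k s \<partial>lborel)"
proof (cases "(\<integral>\<^sup>+s. k s \<partial>lborel) = \<infinity>")
  case False
  define g where "g s = (if s \<in> {a<..<b} - S then h' s else 0)" for s
  have int_g: "(g has_integral (h b - h a)) {a..b}"
    using cont der
    by (intro fundamental_theorem_of_calculus_interior_strong[OF S ab])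
       (auto simp: g_def has_real_derivative_iff_has_vector_derivative[symmetric])
  have "integrable lborel k"
    using k False by (intro integrableI_nonneg) (auto simp: less_top)
  then have int_k: "(k has_integral (LINT s|lborel. k s)) UNIV"
    by (rule has_integral_integral_lborel)
  then have k_ab: "k integrable_on {a..b}"
    by (metis has_integral_integrable integrable_on_subinterval subset_UNIV)
  have "\<bar>h b - h a\<bar> = norm (integral {a..b} g)"
    using int_g by (simp add: integral_unique)
  also have "\<dots> \<le> integral {a..b} k"
    using int_g k_ab bound k(2)
    by (intro integral_norm_bound_integral has_integral_integrable[OF int_g]) (auto simp: g_def)
  also have "\<dots> \<le> integral UNIV k"
    using k_ab int_k k(2) by (intro integral_subset_le) auto
  also have "\<dots> = (LINT s|lborel. k s)"
    using int_k by (rule integral_unique)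
  finally have "ennreal \<bar>h b - h a\<bar> \<le> ennreal (LINT s|lborel. k s)"
    by (rule ennreal_leI)
  also have "\<dots> = (\<integral>\<^sup>+s. k s \<partial>lborel)"
    using \<open>integrable lborel k\<close> k(2) by (intro nn_integral_eq_integral[symmetric]) auto
  finally show ?thesis .
qed simp

lemma has_real_derivative_abs_powr:
  fixes x p :: real
  assumes p: "1 < p"
  shows "((\<lambda>x. \<bar>x\<bar> powr p) has_real_derivative p * \<bar>x\<bar> powr (p - 1) * sgn x) (at x)"
proof (cases "x = 0")
  case False
  have "((\<lambda>x. (x * sgn c) powr p) has_real_derivative p * \<bar>x\<bar> powr (p - 1) * sgn x) (at x)"
    if "sgn c = sgn x" for c
    using False that by (auto intro!: derivative_eq_intros simp: abs_sgn[symmetric])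
  from this[OF refl] show ?thesis
  proof (rule has_field_derivative_transform_within_open)
    show "open {y. 0 < y * x}" "x \<in> {y. 0 < y * x}"
      using False by (auto intro!: open_Collect_less continuous_intros simp: zero_less_mult_iff[of x x])
    show "(y * sgn x) powr p = \<bar>y\<bar> powr p" if "y \<in> {y. 0 < y * x}" for y
      using that by (auto simp: zero_less_mult_iff sgn_if abs_if)
  qed
next
  case True
  have "((\<lambda>h. (\<bar>h\<bar> powr p) / h) \<longlongrightarrow> 0) (at 0)"
  proof (rule tendsto_rabs_zero_cancel)
    have "((\<lambda>h::real. \<bar>h\<bar> powr (p - 1)) \<longlongrightarrow> 0) (at 0)"
    proof -
      have "((\<lambda>h::real. \<bar>h\<bar> powr (p - 1)) \<longlongrightarrow> 0 powr (p - 1)) (at 0)"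
        using p by (intro tendsto_powr') (auto intro!: tendsto_eq_intros)
      then show ?thesis by simp
    qed
    moreover have "\<bar>\<bar>h\<bar> powr p / h\<bar> = \<bar>h\<bar> powr (p - 1)" for h :: real
      by (cases "h = 0") (auto simp: powr_diff abs_divide)
    ultimately show "((\<lambda>h. \<bar>(\<bar>h\<bar> powr p) / h\<bar>) \<longlongrightarrow> 0) (at (0::real))"
      by simp
  qed
  with True p show ?thesis
    by (simp add: DERIV_def)
qed

lemma has_real_derivative_abs:
  fixes x :: real
  assumes "x \<noteq> 0"
  shows "((\<lambda>x. \<bar>x\<bar>) has_real_derivative sgn x) (at x)"
proof (cases "0 < x")
  case True
  have "((\<lambda>x. x) has_real_derivative 1) (at x)" by simp
  then have "((\<lambda>x. \<bar>x\<bar>) has_real_derivative 1) (at x)"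
    by (rule has_field_derivative_transform_within_open[where S="{0<..}"]) (use True in auto)
  with True show ?thesis by simp
next
  case False
  have "((\<lambda>x. - x) has_real_derivative - 1) (at x)"
    by (auto intro!: derivative_eq_intros)
  then have "((\<lambda>x. \<bar>x\<bar>) has_real_derivative - 1) (at x)"
    by (rule has_field_derivative_transform_within_open[where S="{..<0}"]) (use assms False in auto)
  with assms False show ?thesis by simp
qed

lemma powr_square: "(r powr a)\<^sup>2 = r powr (2 * a)" for r a :: real
  by (simp add: power2_eq_square powr_add[symmetric])

lemma Cauchy_Schwarz_integral:
  fixes f g :: "'a \<Rightarrow> real"
  assumes f: "integrable M (\<lambda>x. (f x)\<^sup>2)" "\<And>x. 0 \<le> f x" "f \<in> borel_measurable M"
    and g: "integrable M (\<lambda>x. (g x)\<^sup>2)" "\<And>x. 0 \<le> g x" "g \<in> borel_measurable M"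
    and fg: "integrable M (\<lambda>x. f x * g x)"
  shows "(LINT x|M. f x * g x)\<^sup>2 \<le> (LINT x|M. (f x)\<^sup>2) * (LINT x|M. (g x)\<^sup>2)"
proof -
  have "ennreal ((LINT x|M. f x * g x)\<^sup>2) = (\<integral>\<^sup>+x. ennreal (f x) * ennreal (g x) \<partial>M)\<^sup>2"
    using f g fg
    by (simp add: ennreal_power[symmetric] nn_integral_eq_integral ennreal_mult'[symmetric])
  also have "\<dots> \<le> (\<integral>\<^sup>+x. ennreal (f x) ^ 2 \<partial>M) * (\<integral>\<^sup>+x. ennreal (g x) ^ 2 \<partial>M)"
    using f g by (intro Cauchy_Schwarz_nn_integral) auto
  also have "\<dots> = ennreal ((LINT x|M. (f x)\<^sup>2) * (LINT x|M. (g x)\<^sup>2))"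
    using f g by (simp add: ennreal_power nn_integral_eq_integral ennreal_mult)
  finally show ?thesis
    by (simp add: ennreal_le_iff)
qed

section \<open>Smooth functions supported in the cylinder\<close>

text \<open>The bound for \<open>\<integral> g\<^sup>p\<close> at energy 1, where \<open>p\<close> is the critical exponent if \<open>N \<ge> 3\<close> and an even integer
  above \<open>Q\<close> if \<open>N = 2\<close>. Here \<open>c\<close> bounds \<open>\<integral> \<bar>\<nabla>g\<bar>\<^sup>2\<close> at energy 1; for \<open>N = 2\<close> the factor with index \<open>j\<close> is the
  cost of passing from the exponent \<open>2(j + 1)\<close> to \<open>2(j + 2)\<close>.\<close>
definition Sobolev_const :: "nat \<Rightarrow> real \<Rightarrow> real \<Rightarrow> real" where
  "Sobolev_const N c Q =
     (if N = 2 then 16 * (\<Prod>j<nat \<lceil>Q\<rceil>. (real j + 2)\<^sup>2 * c)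
      else ((2 * (real N - 1) / (real N - 2))\<^sup>2 * c) powr (real N / (real N - 2)))"

lemma Sobolev_const_nonneg: "0 \<le> c \<Longrightarrow> 0 \<le> Sobolev_const N c Q"
  by (auto simp: Sobolev_const_def intro!: prod_nonneg)

text \<open>A continuously differentiable function on the cylinder. The support has distance at least \<open>1 - m\<close> from the
  boundary, so all integrands below are continuous with compact support even though the weights
  are singular at \<open>\<lambda> = \<plusminus>1\<close>.\<close>
locale cylinder_function =
  fixes f :: "'b::euclidean_space \<times> real \<Rightarrow> real"
    and D :: "'b \<times> real \<Rightarrow> 'b \<times> real \<Rightarrow> real"
    and m \<alpha> \<sigma> :: real
  assumes deriv_f: "\<And>z. (f has_derivative D z) (at z)"
    and cont_D: "\<And>v. continuous_on UNIV (\<lambda>z. D z v)"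
    and m: "0 < m" "m < 1"
    and supp: "\<And>z. f z \<noteq> 0 \<Longrightarrow> norm (fst z) \<le> m \<and> \<bar>snd z\<bar> \<le> m"
    and \<sigma>: "2 < \<sigma>" "\<sigma> < -2 * \<alpha>"
begin

text \<open>Up to constants, \<open>H\<close> dominates the length of the gradient of \<open>g\<close> in the variables \<open>(x, s)\<close> with
  \<open>\<partial>\<^sub>s = r\<^bsup>\<sigma>/2\<^esup> \<partial>\<^sub>\<lambda>\<close>; its last term comes from differentiating \<open>r\<^sup>\<beta>\<close>. The factor \<open>rho z powr (- \<sigma> / 2)\<close> in
  \<open>X a\<close> is the density of \<open>dx ds\<close>.\<close>
definition "\<beta> = \<alpha> / 2 + \<sigma> / 4"
definition "rho z = 1 - \<bar>snd z\<bar>" for z :: "'b \<times> real"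
definition "grad z = sqrt (\<Sum>b\<in>Basis. (D z (b, 0))\<^sup>2)" for z
definition "f\<^sub>t z = D z (0, 1)" for z
definition "g z = rho z powr \<beta> * \<bar>f z\<bar>" for z
definition "H z = rho z powr \<beta> * grad z + rho z powr (\<beta> + \<sigma> / 2) * \<bar>f\<^sub>t z\<bar>
   + \<bar>\<beta>\<bar> * rho z powr (\<beta> - 1 + \<sigma> / 2) * \<bar>f z\<bar>" for z
definition "X a = (LINT z|lborel. g z powr a * rho z powr (- \<sigma> / 2))" for a
definition "E = (LINT z|lborel. rho z powr \<alpha> * ((grad z)\<^sup>2 + rho z powr \<sigma> * \<bar>f\<^sub>t z\<bar>\<^sup>2))"
definition "K = cball (0::'b) m \<times> {-m..m}"

lemma \<beta>_neg: "\<beta> < 0"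
  using \<sigma> by (simp add: \<beta>_def)

lemma compact_K: "compact K"
  unfolding K_def by (intro compact_Times) auto

lemma f_outside: "z \<notin> K \<Longrightarrow> f z = 0"
  using supp[of z] by (cases "f z = 0") (auto simp: K_def mem_Times_iff abs_le_iff)

lemma D_outside: assumes "z \<notin> K" shows "D z v = 0"
proof -
  have "open (- K)"
    using compact_K by (intro open_Compl compact_imp_closed)
  then have "(f has_derivative (\<lambda>_. 0)) (at z)"
    by (rule has_derivative_transform_within_open[where f="\<lambda>_. 0", OF has_derivative_const])
       (use assms f_outside in auto)
  from has_derivative_unique[OF deriv_f this] show ?thesis
    by simp
qed

lemma grad_outside: "z \<notin> K \<Longrightarrow> grad z = 0"
  by (simp add: grad_def D_outside)

lemma ft_outside: "z \<notin> K \<Longrightarrow> f\<^sub>t z = 0"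
  by (simp add: f\<^sub>t_def D_outside)

lemma g_outside: "z \<notin> K \<Longrightarrow> g z = 0"
  by (simp add: g_def f_outside)

lemma rho_pos: "z \<in> K \<Longrightarrow> 0 < rho z"
  using m by (auto simp: K_def rho_def)

lemma rho_le_1: "rho z \<le> 1"
  by (simp add: rho_def)

lemma grad_nonneg: "0 \<le> grad z"
  by (simp add: grad_def sum_nonneg)

lemma g_nonneg: "0 \<le> g z"
  by (simp add: g_def)

lemma H_nonneg: "0 \<le> H z"
  by (simp add: H_def grad_nonneg)

lemma abs_D_le_grad:
  assumes "b \<in> Basis" shows "\<bar>D z (b, 0)\<bar> \<le> grad z"
proof -
  have "(D z (b, 0))\<^sup>2 \<le> (\<Sum>b\<in>Basis. (D z (b, 0))\<^sup>2)"
    using assms by (intro member_le_sum) auto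
  then show ?thesis
    using real_sqrt_le_mono[of "(D z (b, 0))\<^sup>2"] by (simp add: grad_def)
qed

lemma cont_f [continuous_intros]: "continuous_on S f"
  by (intro continuous_at_imp_continuous_on ballI has_derivative_continuous[OF deriv_f])

lemma cont_rho [continuous_intros]: "continuous_on S rho"
  unfolding rho_def by (intro continuous_intros)

lemma cont_rho_powr [continuous_intros]: "continuous_on K (\<lambda>z. rho z powr a)"
  by (intro continuous_intros) (auto dest!: rho_pos)

lemma cont_ft [continuous_intros]: "continuous_on S f\<^sub>t"
  unfolding f\<^sub>t_def by (rule continuous_on_subset[OF cont_D]) auto

lemma cont_grad [continuous_intros]: "continuous_on S grad"
  unfolding grad_def by (intro continuous_intros continuous_on_subset[OF cont_D]) auto

lemma cont_g [continuous_intros]: "continuous_on K g"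
  unfolding g_def by (intro continuous_intros)

lemma cont_g_powr [continuous_intros]: "0 < a \<Longrightarrow> continuous_on K (\<lambda>z. g z powr a)"
  by (intro continuous_on_powr' continuous_intros) (auto simp: g_nonneg)

lemma cont_H [continuous_intros]: "continuous_on K H"
  unfolding H_def by (intro continuous_intros)

lemma integrable_K:
  fixes \<phi> :: "'b \<times> real \<Rightarrow> real"
  assumes "continuous_on K \<phi>" and "\<And>z. z \<notin> K \<Longrightarrow> \<phi> z = 0"
  shows "integrable lborel \<phi>"
proof -
  have "integrable lborel (\<lambda>z. indicator K z *\<^sub>R \<phi> z)"
    using compact_K assms(1) by (rule borel_integrable_compact)
  also have "(\<lambda>z. indicator K z *\<^sub>R \<phi> z) = \<phi>"
    using assms(2) by (auto simp: indicator_def fun_eq_iff)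
  finally show ?thesis .
qed

lemma measurable_K:
  fixes \<phi> :: "'b \<times> real \<Rightarrow> real"
  assumes "continuous_on K \<phi>" and "\<And>z. z \<notin> K \<Longrightarrow> \<phi> z = 0"
  shows "\<phi> \<in> borel_measurable borel"
  using borel_measurable_integrable[OF integrable_K[OF assms]] by simp

lemma integrable_X: "0 < a \<Longrightarrow> integrable lborel (\<lambda>z. g z powr a * rho z powr c)"
  by (intro integrable_K continuous_intros) (auto simp: g_outside)

lemma X_nonneg: "0 \<le> X a"
  unfolding X_def by (intro integral_nonneg_AE) auto

lemma integrable_E: "integrable lborel (\<lambda>z. rho z powr \<alpha> * ((grad z)\<^sup>2 + rho z powr \<sigma> * \<bar>f\<^sub>t z\<bar>\<^sup>2))"
  by (intro integrable_K continuous_intros) (auto simp: grad_outside ft_outside)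

lemma E_nonneg: "0 \<le> E"
  unfolding E_def by (intro integral_nonneg_AE) auto

section \<open>Pointwise bounds by line integrals\<close>

lemma has_real_derivative_line:
  "((\<lambda>y. f (z + (y - c) *\<^sub>R e)) has_real_derivative D (z + (y - c) *\<^sub>R e) e) (at y)"
proof -
  let ?w = "z + (y - c) *\<^sub>R e"
  have "((\<lambda>y. z + (y - c) *\<^sub>R e) has_derivative (\<lambda>h. h *\<^sub>R e)) (at y)"
    by (auto intro!: derivative_eq_intros)
  from has_derivative_compose[OF this deriv_f]
  have "((\<lambda>y. f (z + (y - c) *\<^sub>R e)) has_derivative (\<lambda>h. D ?w (h *\<^sub>R e))) (at y)" .
  moreover have "linear (D ?w)"
    by (rule has_derivative_linear[OF deriv_f])
  ultimately show ?thesis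
    by (simp add: has_field_derivative_def linear_scale mult.commute[of _ "D ?w e"] )
qed

text \<open>The function \<open>g\<^sup>\<gamma>\<close> vanishes at the end of the line, so its value is at most the integral of its
  derivative; the weights are constant along a line in an \<open>x\<close> direction.\<close>
lemma line_bound_fst:
  assumes \<gamma>: "1 < \<gamma>" and b: "b \<in> Basis" and z: "z \<in> K"
  defines "e \<equiv> (b, 0)"
  shows "ennreal (rho z powr (-\<sigma> / 2) * g z powr \<gamma>) \<le>
    (\<integral>\<^sup>+y. ennreal (\<gamma> * (g (z + (y - z \<bullet> e) *\<^sub>R e) powr (\<gamma> - 1)
       * (rho (z + (y - z \<bullet> e) *\<^sub>R e) powr (\<beta> - \<sigma> / 2) * grad (z + (y - z \<bullet> e) *\<^sub>R e)))) \<partial>lborel)"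
proof -
  define P where "P y = z + (y - z \<bullet> e) *\<^sub>R e" for y
  define k where "k w = \<gamma> * (g w powr (\<gamma> - 1) * (rho w powr (\<beta> - \<sigma> / 2) * grad w))" for w
  define \<omega> where "\<omega> = rho z powr (-\<sigma> / 2) * (rho z powr \<beta>) powr \<gamma>"
  define h where "h y = \<omega> * \<bar>f (P y)\<bar> powr \<gamma>" for y
  define h' where "h' y = \<omega> * (\<gamma> * \<bar>f (P y)\<bar> powr (\<gamma> - 1) * sgn (f (P y)) * D (P y) e)" for y
  have rho_P: "rho (P y) = rho z" for y
    by (simp add: rho_def P_def e_def)
  have rho_pos: "0 < rho z"
    using z by (rule rho_pos)
  have fst_P: "fst (P y) \<bullet> b = y" for y
    using b by (simp add: P_def e_def inner_add_left inner_prod_def)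
  have Pz: "P (z \<bullet> e) = z"
    by (simp add: P_def)
  have ze: "z \<bullet> e \<le> 1"
  proof -
    have "z \<bullet> e = fst z \<bullet> b" by (simp add: e_def inner_prod_def)
    also have "\<dots> \<le> norm (fst z)" using b norm_cauchy_schwarz[of "fst z" b] by simp
    also have "\<dots> \<le> 1" using z m by (auto simp: K_def)
    finally show ?thesis .
  qed
  have end0: "f (P 1) = 0"
  proof (rule f_outside)
    have "1 \<le> norm (fst (P 1))"
      using fst_P[of 1] b norm_cauchy_schwarz[of "fst (P 1)" b] by simp
    then show "P 1 \<notin> K"
      using m by (cases "P 1") (auto simp: K_def)
  qed
  have kmeas: "k \<in> borel_measurable borel"
    unfolding k_def using \<gamma>
    by (intro measurable_K continuous_intros) (auto simp: g_outside)
  have der: "(h has_real_derivative h' y) (at y)" for y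
    unfolding h_def h'_def
    using DERIV_chain2[OF has_real_derivative_abs_powr[OF \<gamma>] has_real_derivative_line[of z "z \<bullet> e" e y]]
    by (intro DERIV_cmult) (simp only: P_def)
  have "ennreal \<bar>h 1 - h (z \<bullet> e)\<bar> \<le> (\<integral>\<^sup>+y. ennreal (k (P y)) \<partial>lborel)"
  proof (rule increment_le_nn_integral[where S="{}" and h=h and h'=h' and a="z \<bullet> e" and b=1])
    show "continuous_on {z \<bullet> e..1} h"
      using der by (meson DERIV_isCont continuous_at_imp_continuous_on)
    show "(\<lambda>y. k (P y)) \<in> borel_measurable borel"
      by (rule measurable_compose[OF _ kmeas]) (simp add: P_def)
    show "0 \<le> k (P y)" for y
      using \<gamma> by (simp add: k_def grad_nonneg)
    show "\<bar>h' y\<bar> \<le> k (P y)" if "y \<in> {z \<bullet> e<..<1} - {}" for y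
    proof -
      have pw: "(rho z powr \<beta>) powr \<gamma> = (rho z powr \<beta>) powr (\<gamma> - 1) * rho z powr \<beta>"
        using rho_pos by (simp add: powr_diff)
      have "\<bar>h' y\<bar> = \<omega> * (\<gamma> * \<bar>f (P y)\<bar> powr (\<gamma> - 1) * \<bar>D (P y) e\<bar>)"
        using \<gamma> by (cases "f (P y) = 0") (auto simp: h'_def \<omega>_def abs_mult abs_sgn_eq)
      also have "\<dots> \<le> \<omega> * (\<gamma> * \<bar>f (P y)\<bar> powr (\<gamma> - 1) * grad (P y))"
        using \<gamma> abs_D_le_grad[OF b, of "P y"]
        by (intro mult_left_mono) (auto simp: \<omega>_def e_def)
      also have "\<dots> = k (P y)"
      proof -
        have split: "rho z powr (\<beta> - \<sigma> / 2) = rho z powr \<beta> * rho z powr (- \<sigma> / 2)"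
          by (simp add: powr_add[symmetric])
        show ?thesis
          unfolding k_def g_def rho_P \<omega>_def pw split by (simp add: powr_mult mult_ac)
      qed
      finally show ?thesis .
    qed
  qed (use ze der in auto)
  also have "h 1 = 0"
    using end0 by (simp add: h_def)
  also have "\<bar>0 - h (z \<bullet> e)\<bar> = rho z powr (-\<sigma> / 2) * g z powr \<gamma>"
    unfolding h_def \<omega>_def Pz g_def by (simp add: powr_mult)
  finally show ?thesis
    by (simp add: k_def P_def)
qed

text \<open>In the \<open>\<lambda>\<close> direction the weight \<open>r\<^bsup>\<beta>\<gamma>\<^esup>\<close> is differentiated too, which produces the last term
  of \<open>H\<close>.\<close>
lemma line_bound_snd:
  assumes \<gamma>: "1 < \<gamma>" and z: "z \<in> K"
  defines "e \<equiv> (0::'b, 1::real)"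
  shows "ennreal (g z powr \<gamma>) \<le>
    (\<integral>\<^sup>+y. ennreal (\<gamma> * (g (z + (y - z \<bullet> e) *\<^sub>R e) powr (\<gamma> - 1)
       * (rho (z + (y - z \<bullet> e) *\<^sub>R e) powr (- \<sigma> / 2) * H (z + (y - z \<bullet> e) *\<^sub>R e)))) \<partial>lborel)"
proof -
  define P where "P y = z + (y - z \<bullet> e) *\<^sub>R e" for y
  define k where "k w = \<gamma> * (g w powr (\<gamma> - 1) * (rho w powr (- \<sigma> / 2) * H w))" for w
  define \<psi> where "\<psi> s = (1 - \<bar>s\<bar>) powr (\<beta> * \<gamma>)" for s :: real
  define h where "h s = \<psi> s * \<bar>f (P s)\<bar> powr \<gamma>" for s
  define h' where "h' s = (- (\<beta> * \<gamma>) * (1 - \<bar>s\<bar>) powr (\<beta> * \<gamma> - 1) * sgn s) * \<bar>f (P s)\<bar> powr \<gamma>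
     + \<psi> s * (\<gamma> * \<bar>f (P s)\<bar> powr (\<gamma> - 1) * sgn (f (P s)) * f\<^sub>t (P s))" for s
  \<comment> \<open>An end point beyond the support of \<open>f\<close> but before the singularity of the weight.\<close>
  define m' where "m' = (1 + m) / 2"
  have m': "m < m'" "m' < 1"
    using m by (auto simp: m'_def)
  have snd_P: "snd (P s) = s" for s
    by (simp add: P_def e_def inner_prod_def)
  have rho_P: "rho (P s) = 1 - \<bar>s\<bar>" for s
    by (simp add: rho_def snd_P)
  have Pz: "P (z \<bullet> e) = z"
    by (simp add: P_def)
  have ze: "\<bar>z \<bullet> e\<bar> \<le> m"
    using z by (auto simp: K_def e_def inner_prod_def)
  have end0: "f (P m') = 0"
    using snd_P[of m'] m' m by (intro f_outside) (cases "P m'", auto simp: K_def)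
  have kmeas: "k \<in> borel_measurable borel"
    unfolding k_def using \<gamma>
    by (intro measurable_K continuous_intros) (auto simp: g_outside)
  have der_f: "((\<lambda>s. \<bar>f (P s)\<bar> powr \<gamma>) has_real_derivative
      \<gamma> * \<bar>f (P s)\<bar> powr (\<gamma> - 1) * sgn (f (P s)) * f\<^sub>t (P s)) (at s)" for s
    using DERIV_chain2[OF has_real_derivative_abs_powr[OF \<gamma>] has_real_derivative_line[of z "z \<bullet> e" e s]]
    by (simp only: P_def f\<^sub>t_def e_def)
  have "ennreal \<bar>h m' - h (z \<bullet> e)\<bar> \<le> (\<integral>\<^sup>+y. ennreal (k (P y)) \<partial>lborel)"
  proof (rule increment_le_nn_integral[where S="{0}" and h=h and h'=h' and a="z \<bullet> e" and b=m'])
    show "z \<bullet> e \<le> m'"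
      using ze m' by linarith
    have "continuous_on {z \<bullet> e..m'} (\<lambda>s. \<bar>f (P s)\<bar> powr \<gamma>)"
      using der_f by (meson DERIV_isCont continuous_at_imp_continuous_on)
    moreover have "continuous_on {z \<bullet> e..m'} \<psi>"
      unfolding \<psi>_def using ze m' by (intro continuous_intros) auto
    ultimately show "continuous_on {z \<bullet> e..m'} h"
      unfolding h_def by (rule continuous_on_mult[rotated])
    show "(\<lambda>y. k (P y)) \<in> borel_measurable borel"
      by (rule measurable_compose[OF _ kmeas]) (simp add: P_def)
    show "0 \<le> k (P y)" for y
      using \<gamma> by (simp add: k_def H_nonneg)
    fix s assume s: "s \<in> {z \<bullet> e<..<m'} - {0}"
    then have s1: "0 < 1 - \<bar>s\<bar>" and s0: "s \<noteq> 0"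
      using ze m' by auto
    have "((\<lambda>s. \<bar>s\<bar>) has_real_derivative sgn s) (at s)"
      using s0 by (rule has_real_derivative_abs)
    then have "(\<psi> has_real_derivative - (\<beta> * \<gamma>) * (1 - \<bar>s\<bar>) powr (\<beta> * \<gamma> - 1) * sgn s) (at s)"
      unfolding \<psi>_def using s1 by (auto intro!: derivative_eq_intros simp: powr_diff)
    from DERIV_mult[OF this der_f] show "(h has_real_derivative h' s) (at s)"
      unfolding h_def h'_def by (simp add: algebra_simps)
    define r where "r = 1 - \<bar>s\<bar>"
    have r: "0 < r" using s1 by (simp add: r_def)
    have "\<bar>h' s\<bar> \<le> (\<bar>\<beta>\<bar> * \<gamma> * r powr (\<beta> * \<gamma> - 1)) * \<bar>f (P s)\<bar> powr \<gamma>
        + r powr (\<beta> * \<gamma>) * (\<gamma> * \<bar>f (P s)\<bar> powr (\<gamma> - 1) * \<bar>f\<^sub>t (P s)\<bar>)"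
      unfolding h'_def \<psi>_def r_def[symmetric] using \<gamma> s0
      by (intro order_trans[OF abs_triangle_ineq] add_mono)
         (auto simp: abs_mult abs_sgn_eq)
    also have "\<dots> = \<gamma> * ((r powr (\<beta> * (\<gamma> - 1)) * \<bar>f (P s)\<bar> powr (\<gamma> - 1)) * (r powr (- \<sigma> / 2) *
        (r powr (\<beta> + \<sigma> / 2) * \<bar>f\<^sub>t (P s)\<bar> + \<bar>\<beta>\<bar> * r powr (\<beta> - 1 + \<sigma> / 2) * \<bar>f (P s)\<bar>)))"
    proof -
      have 1: "r powr (\<beta> * \<gamma> - 1) = r powr (\<beta> * (\<gamma> - 1)) * r powr (- \<sigma> / 2) * r powr (\<beta> - 1 + \<sigma> / 2)"
        by (simp add: powr_add[symmetric] algebra_simps)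
      have 2: "r powr (\<beta> * \<gamma>) = r powr (\<beta> * (\<gamma> - 1)) * r powr (- \<sigma> / 2) * r powr (\<beta> + \<sigma> / 2)"
        by (simp add: powr_add[symmetric] algebra_simps)
      have 3: "\<bar>f (P s)\<bar> powr \<gamma> = \<bar>f (P s)\<bar> powr (\<gamma> - 1) * \<bar>f (P s)\<bar>"
        by (simp add: powr_diff)
      show ?thesis
        unfolding 1 2 3 by (simp add: algebra_simps)
    qed
    also have "\<dots> \<le> k (P s)"
      unfolding k_def g_def H_def rho_P r_def[symmetric] using \<gamma>
      by (intro mult_left_mono mult_mono) (auto simp: powr_mult powr_powr grad_nonneg)
    finally show "\<bar>h' s\<bar> \<le> k (P s)" .
  qed auto
  also have "h m' = 0"
    using end0 by (simp add: h_def)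
  also have "\<bar>0 - h (z \<bullet> e)\<bar> = g z powr \<gamma>"
  proof -
    have "1 - \<bar>z \<bullet> e\<bar> = rho z"
      using rho_P[of "z \<bullet> e"] by (simp add: Pz)
    then show ?thesis
      unfolding h_def \<psi>_def Pz g_def by (simp add: powr_mult powr_powr)
  qed
  finally show ?thesis
    by (simp add: k_def P_def)
qed

section \<open>The Poincare and Sobolev inequalities for the weighted function\<close>

lemma g_square: "(g z * rho z powr (-\<sigma> / 4))\<^sup>2 = g z powr 2 * rho z powr (-\<sigma> / 2)"
  by (simp add: power_mult_distrib powr_square g_nonneg powr_numeral)

text \<open>The line bound with \<open>\<gamma> = 2\<close> in a single \<open>x\<close> direction, integrated over the strip of width 2 that
  contains the cylinder, gives \<open>X 2 \<le> 4 \<integral> g \<bar>\<nabla>\<^sub>x g\<bar>\<close>. After the Cauchy-Schwarz inequality the finite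
  number \<open>X 2\<close> can be cancelled.\<close>
lemma Poincare: "X 2 \<le> 16 * E"
proof -
  obtain b :: 'b where b: "b \<in> Basis"
    using nonempty_Basis by blast
  define e where "e = (b, 0::real)"
  have e: "norm e = 1"
    using b by (simp add: e_def norm_Pair)
  define k where "k z = (g z * rho z powr (-\<sigma> / 4)) * (rho z powr (\<beta> - \<sigma> / 4) * grad z)" for z
  have cont_k: "continuous_on K k"
    unfolding k_def by (intro continuous_intros)
  have k_outside: "z \<notin> K \<Longrightarrow> k z = 0" for z
    by (simp add: k_def g_outside)
  note int_k = integrable_K[OF cont_k k_outside]
  have k_nonneg: "0 \<le> k z" for z
    by (simp add: k_def g_nonneg grad_nonneg)
  have k_eq: "2 * (g z powr (2 - 1) * (rho z powr (\<beta> - \<sigma> / 2) * grad z)) = 2 * k z" for z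
  proof -
    have "rho z powr (\<beta> - \<sigma> / 2) = rho z powr (-\<sigma> / 4) * rho z powr (\<beta> - \<sigma> / 4)"
      by (simp add: powr_add[symmetric])
    then show ?thesis
      by (simp add: k_def g_nonneg)
  qed
  have "ennreal (X 2) = (\<integral>\<^sup>+z. ennreal (g z powr 2 * rho z powr (-\<sigma> / 2)) \<partial>lborel)"
    unfolding X_def by (intro nn_integral_eq_integral[symmetric] integrable_X) auto
  also have "\<dots> \<le> (\<integral>\<^sup>+z. indicator {-1..1} (z \<bullet> e) *
      (\<integral>\<^sup>+y. ennreal (2 * k (z + (y - z \<bullet> e) *\<^sub>R e)) \<partial>lborel) \<partial>lborel)"
  proof (intro nn_integral_mono)
    fix z :: "'b \<times> real"
    show "ennreal (g z powr 2 * rho z powr (-\<sigma> / 2)) \<le> indicator {-1..1} (z \<bullet> e) *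
      (\<integral>\<^sup>+y. ennreal (2 * k (z + (y - z \<bullet> e) *\<^sub>R e)) \<partial>lborel)"
    proof (cases "z \<in> K")
      case True
      have "\<bar>z \<bullet> e\<bar> = \<bar>fst z \<bullet> b\<bar>"
        by (simp add: e_def inner_prod_def)
      also have "\<dots> \<le> norm (fst z)"
        using b by (simp add: Basis_le_norm)
      also have "\<dots> \<le> 1"
        using True m by (auto simp: K_def)
      finally have "z \<bullet> e \<in> {-1..1}"
        by (simp add: abs_le_iff)
      with line_bound_fst[of 2, OF _ b True] show ?thesis
        by (simp add: k_eq[simplified] e_def[symmetric] mult.commute[of "rho z powr _"])
    qed (simp add: g_outside)
  qed
  also have "\<dots> = 2 * (\<integral>\<^sup>+z. ennreal (2 * k z) \<partial>lborel)"
    using borel_measurable_integrable[OF int_k] by (intro nn_integral_strip e) auto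
  also have "(\<integral>\<^sup>+z. ennreal (2 * k z) \<partial>lborel) = ennreal (LINT z|lborel. 2 * k z)"
    using int_k k_nonneg by (intro nn_integral_eq_integral) auto
  also have "2 * \<dots> = ennreal (4 * (LINT z|lborel. k z))"
    using k_nonneg by (simp add: ennreal_mult' flip: ennreal_numeral)
       (simp add: mult.assoc[symmetric] flip: ennreal_mult')
  finally have X2: "X 2 \<le> 4 * (LINT z|lborel. k z)"
    using k_nonneg by (subst (asm) ennreal_le_iff) (auto intro!: mult_nonneg_nonneg integral_nonneg_AE)
  have int_c: "integrable lborel (\<lambda>z. (rho z powr (\<beta> - \<sigma> / 4) * grad z)\<^sup>2)"
    by (intro integrable_K continuous_intros) (auto simp: grad_outside)
  have "(LINT z|lborel. k z)\<^sup>2 \<le> (LINT z|lborel. (g z * rho z powr (-\<sigma> / 4))\<^sup>2)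
      * (LINT z|lborel. (rho z powr (\<beta> - \<sigma> / 4) * grad z)\<^sup>2)"
    unfolding k_def
  proof (rule Cauchy_Schwarz_integral)
    show "integrable lborel (\<lambda>z. (g z * rho z powr (-\<sigma> / 4))\<^sup>2)"
      unfolding g_square by (intro integrable_X) auto
    show "(\<lambda>z. g z * rho z powr (-\<sigma> / 4)) \<in> borel_measurable lborel"
      unfolding measurable_lborel2
      by (intro measurable_K continuous_intros) (auto simp: g_outside)
    show "(\<lambda>z. rho z powr (\<beta> - \<sigma> / 4) * grad z) \<in> borel_measurable lborel"
      unfolding measurable_lborel2
      by (intro measurable_K continuous_intros) (auto simp: grad_outside)
  qed (use int_c int_k k_def in \<open>auto simp: g_nonneg grad_nonneg\<close>)
  also have "(LINT z|lborel. (g z * rho z powr (-\<sigma> / 4))\<^sup>2) = X 2"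
    by (simp only: g_square X_def)
  also have "(LINT z|lborel. (rho z powr (\<beta> - \<sigma> / 4) * grad z)\<^sup>2) \<le> E"
    unfolding E_def
  proof (rule integral_mono[OF int_c integrable_E])
    fix z
    have "2 * (\<beta> - \<sigma> / 4) = \<alpha>" by (simp add: \<beta>_def)
    then have "(rho z powr (\<beta> - \<sigma> / 4) * grad z)\<^sup>2 = rho z powr \<alpha> * (grad z)\<^sup>2"
      by (simp add: power_mult_distrib powr_square)
    then show "(rho z powr (\<beta> - \<sigma> / 4) * grad z)\<^sup>2
        \<le> rho z powr \<alpha> * ((grad z)\<^sup>2 + rho z powr \<sigma> * \<bar>f\<^sub>t z\<bar>\<^sup>2)"
      by (simp add: mult_left_mono)
  qed
  finally have CS: "(LINT z|lborel. k z)\<^sup>2 \<le> X 2 * E"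
    using X_nonneg[of 2] by (simp add: mult_left_mono)
  have "(X 2)\<^sup>2 \<le> (4 * (LINT z|lborel. k z))\<^sup>2"
    using X2 X_nonneg by (intro power_mono) auto
  also have "\<dots> \<le> 16 * (X 2 * E)"
    using CS by (simp add: power_mult_distrib)
  finally have "X 2 * X 2 \<le> X 2 * (16 * E)"
    by (simp add: power2_eq_square)
  then show ?thesis
    using X_nonneg[of 2] E_nonneg by (cases "X 2 = 0") (auto simp: mult_le_cancel_left)
qed

lemma integrable_H: "integrable lborel (\<lambda>z. (H z * rho z powr (-\<sigma> / 4))\<^sup>2)"
  by (intro integrable_K continuous_intros)
     (auto simp: H_def grad_outside ft_outside f_outside)

text \<open>The square of the last term of \<open>H\<close> carries the weight \<open>r\<^bsup>\<alpha>+\<sigma>-2\<^esup> \<le> r\<^sup>\<alpha>\<close>, as \<open>\<sigma> > 2\<close>, and is therefore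
  controlled by the Poincare inequality.\<close>
lemma H_bound: "(LINT z|lborel. (H z * rho z powr (-\<sigma> / 4))\<^sup>2) \<le> (3 + 48 * \<beta>\<^sup>2) * E"
proof -
  have "(LINT z|lborel. (H z * rho z powr (-\<sigma> / 4))\<^sup>2) \<le>
     (LINT z|lborel. 3 * (rho z powr \<alpha> * ((grad z)\<^sup>2 + rho z powr \<sigma> * \<bar>f\<^sub>t z\<bar>\<^sup>2))
        + 3 * \<beta>\<^sup>2 * (g z powr 2 * rho z powr (-\<sigma> / 2)))"
  proof (rule integral_mono[OF integrable_H])
    fix z
    define r where "r = rho z"
    show "(H z * rho z powr (-\<sigma> / 4))\<^sup>2 \<le>
        3 * (rho z powr \<alpha> * ((grad z)\<^sup>2 + rho z powr \<sigma> * \<bar>f\<^sub>t z\<bar>\<^sup>2))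
        + 3 * \<beta>\<^sup>2 * (g z powr 2 * rho z powr (-\<sigma> / 2))"
    proof (cases "z \<in> K")
      case True
      then have r: "0 < r" "r \<le> 1"
        by (auto simp: r_def rho_pos rho_le_1)
      define a where "a = r powr (\<alpha> / 2) * grad z"
      define b where "b = r powr (\<alpha> / 2 + \<sigma> / 2) * \<bar>f\<^sub>t z\<bar>"
      define c where "c = \<bar>\<beta>\<bar> * r powr (\<alpha> / 2 + \<sigma> / 2 - 1) * \<bar>f z\<bar>"
      have "H z * r powr (-\<sigma> / 4) = a + b + c"
        unfolding H_def r_def[symmetric] a_def b_def c_def \<beta>_def
        by (simp add: distrib_right mult.commute[of _ "r powr (-(\<sigma>/4))"]
              mult.assoc[symmetric] mult.left_commute[of _ "\<bar>_\<bar>"] powr_add[symmetric])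
           (simp add: algebra_simps powr_add[symmetric])
      moreover have "(a + b + c)\<^sup>2 \<le> 3 * (a\<^sup>2 + b\<^sup>2) + 3 * c\<^sup>2"
      proof -
        have "0 \<le> (a - b)\<^sup>2 + (b - c)\<^sup>2 + (a - c)\<^sup>2" by simp
        then show ?thesis by (simp add: power2_eq_square algebra_simps)
      qed
      moreover have "a\<^sup>2 + b\<^sup>2 = r powr \<alpha> * ((grad z)\<^sup>2 + r powr \<sigma> * \<bar>f\<^sub>t z\<bar>\<^sup>2)"
        by (simp add: a_def b_def power_mult_distrib powr_square distrib_left powr_add)
      moreover have "c\<^sup>2 \<le> \<beta>\<^sup>2 * (g z powr 2 * r powr (-\<sigma> / 2))"
      proof -
        have "c\<^sup>2 = \<beta>\<^sup>2 * (r powr (\<alpha> + \<sigma> - 2) * \<bar>f z\<bar>\<^sup>2)"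
          by (simp add: c_def power_mult_distrib powr_square algebra_simps)
        also have "\<dots> \<le> \<beta>\<^sup>2 * (r powr \<alpha> * \<bar>f z\<bar>\<^sup>2)"
          using r \<sigma> by (intro mult_left_mono mult_right_mono powr_mono') auto
        also have "r powr \<alpha> * \<bar>f z\<bar>\<^sup>2 = (r powr \<beta>)\<^sup>2 * r powr (-\<sigma> / 2) * \<bar>f z\<bar>\<^sup>2"
          unfolding powr_square powr_add[symmetric] by (simp add: \<beta>_def)
        also have "\<dots> = g z powr 2 * r powr (-\<sigma> / 2)"
          by (simp add: g_nonneg powr_numeral) (simp add: g_def r_def power_mult_distrib)
        finally show ?thesis .
      qed
      ultimately show ?thesis
        unfolding r_def[symmetric] by (simp add: mult.assoc)
    qed (simp add: H_def grad_outside ft_outside f_outside)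
  next
    show "integrable lborel (\<lambda>z. 3 * (rho z powr \<alpha> * ((grad z)\<^sup>2 + rho z powr \<sigma> * \<bar>f\<^sub>t z\<bar>\<^sup>2))
        + 3 * \<beta>\<^sup>2 * (g z powr 2 * rho z powr (-\<sigma> / 2)))"
      by (intro Bochner_Integration.integrable_add integrable_mult_right integrable_E integrable_X) auto
  qed
  also have "\<dots> = 3 * E + 3 * \<beta>\<^sup>2 * X 2"
    unfolding E_def X_def
    by (subst Bochner_Integration.integral_add)
       (use integrable_E integrable_X[of 2 "- \<sigma> / 2"] in auto)
  also have "\<dots> \<le> 3 * E + 3 * \<beta>\<^sup>2 * (16 * E)"
    using Poincare by (intro add_left_mono mult_left_mono) auto
  finally show ?thesis
    by (simp add: algebra_simps)
qed

text \<open>With \<open>L\<close> the line integrals of \<open>k = \<gamma> g\<^bsup>\<gamma>-1\<^esup> H r\<^bsup>-\<sigma>/2\<^esup>\<close>, the line bounds read \<open>g\<^sup>\<gamma> \<le> L\<close> in the \<open>\<lambda>\<close> direction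
  and \<open>r\<^bsup>-\<sigma>/2\<^esup> g\<^sup>\<gamma> \<le> L\<close> in the \<open>n - 1\<close> others. Multiplying the powers \<open>1/(n - 1)\<close> of all of them gives
  \<open>g\<^bsup>\<gamma>n/(n-1)\<^esup>\<close> with exactly one factor \<open>r\<^bsup>-\<sigma>/2\<^esup>\<close>, which is the integrand of \<open>X\<close>.\<close>
lemma Sobolev_step:
  assumes \<gamma>: "1 < \<gamma>"
  defines "n \<equiv> real DIM('b) + 1"
  shows "X (\<gamma> * n / (n - 1)) powr (2 * (n - 1) / n) \<le> \<gamma>\<^sup>2 * ((3 + 48 * \<beta>\<^sup>2) * E) * X (2 * (\<gamma> - 1))"
proof -
  have n: "2 \<le> n"
    using DIM_positive[where 'a='b] by (simp add: n_def)
  define k where "k z = \<gamma> * (g z powr (\<gamma> - 1) * (rho z powr (-\<sigma> / 2) * H z))" for z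
  have cont_k: "continuous_on K k"
    unfolding k_def using \<gamma> by (intro continuous_intros) auto
  have k_outside: "z \<notin> K \<Longrightarrow> k z = 0" for z
    using \<gamma> by (simp add: k_def g_outside)
  note int_k = integrable_K[OF cont_k k_outside]
  have k_nonneg: "0 \<le> k z" for z
    using \<gamma> by (simp add: k_def H_nonneg)
  define L where "L z e = (\<integral>\<^sup>+y. ennreal (k (z + (y - z \<bullet> e) *\<^sub>R e)) \<partial>lborel)" for z e
  define p where "p = 1 / (n - 1)"
  have p: "0 < p" using n by (simp add: p_def)
  have pointwise: "ennreal (g z powr (\<gamma> * n / (n - 1)) * rho z powr (-\<sigma> / 2)) \<le> (\<Prod>e\<in>Basis. epow (L z e) p)"
    for z
  proof (cases "z \<in> K \<and> g z \<noteq> 0")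
    case True
    then have zK: "z \<in> K" and gpos: "0 < g z"
      using g_nonneg[of z] by auto
    define r where "r = rho z powr (-\<sigma> / 2)"
    define u where "u = g z powr \<gamma>"
    define e0 where "e0 = (0::'b, 1::real)"
    have r: "0 < r" using rho_pos[OF zK] by (simp add: r_def)
    have u: "0 < u" using gpos by (simp add: u_def)
    have e0: "e0 \<in> Basis"
      by (simp add: e0_def Basis_prod_def)
    have L0: "ennreal u \<le> L z e0"
      unfolding L_def k_def u_def e0_def by (rule line_bound_snd[OF \<gamma> zK])
    have L1: "ennreal (r * u) \<le> L z e" if "e \<in> Basis - {e0}" for e
    proof -
      from that obtain b where b: "b \<in> Basis" and e: "e = (b, 0)"
        by (auto simp: Basis_prod_def e0_def)
      have "ennreal (r * u) \<le> (\<integral>\<^sup>+y. ennreal (\<gamma> * (g (z + (y - z \<bullet> e) *\<^sub>R e) powr (\<gamma> - 1)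
         * (rho (z + (y - z \<bullet> e) *\<^sub>R e) powr (\<beta> - \<sigma> / 2) * grad (z + (y - z \<bullet> e) *\<^sub>R e)))) \<partial>lborel)"
        unfolding r_def u_def e by (rule line_bound_fst[OF \<gamma> b zK])
      also have "\<dots> \<le> L z e"
        unfolding L_def
      proof (intro nn_integral_mono ennreal_leI)
        fix y :: real
        define w where "w = z + (y - z \<bullet> e) *\<^sub>R e"
        have "rho w powr (\<beta> - \<sigma> / 2) * grad w = rho w powr (-\<sigma> / 2) * (rho w powr \<beta> * grad w)"
          by (simp add: powr_add[symmetric] mult.assoc[symmetric])
        also have "\<dots> \<le> rho w powr (-\<sigma> / 2) * H w"
          by (intro mult_left_mono) (auto simp: H_def)
        finally show "\<gamma> * (g w powr (\<gamma> - 1) * (rho w powr (\<beta> - \<sigma> / 2) * grad w)) \<le> k w"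
          unfolding k_def using \<gamma> by (intro mult_left_mono) auto
      qed
      finally show ?thesis .
    qed
    have cardB: "card (Basis - {e0}) = DIM('b)"
      using e0 by simp
    have "(u * (r * u) ^ DIM('b)) powr p = g z powr (\<gamma> * n / (n - 1)) * r"
    proof -
      have "u * (r * u) ^ DIM('b) = u powr n * r powr (n - 1)"
        using u r by (simp add: n_def powr_add powr_realpow power_mult_distrib)
      also have "\<dots> powr p = u powr (n * p) * r powr ((n - 1) * p)"
        using u r by (simp add: powr_mult powr_powr)
      also have "(n - 1) * p = 1" using n by (simp add: p_def)
      finally show ?thesis
        using r by (simp add: u_def powr_powr p_def)
    qed
    then have "ennreal (g z powr (\<gamma> * n / (n - 1)) * r) = epow (ennreal (u * (r * u) ^ DIM('b))) p"
      using u r p by (subst epow_ennreal) auto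
    also have "ennreal (u * (r * u) ^ DIM('b)) = ennreal u * (\<Prod>e\<in>Basis - {e0}. ennreal (r * u))"
      using u r by (subst ennreal_mult) (simp_all add: cardB ennreal_power)
    also have "\<dots> \<le> L z e0 * (\<Prod>e\<in>Basis - {e0}. L z e)"
      by (intro mult_mono prod_mono_ennreal L0 L1) auto
    also have "\<dots> = (\<Prod>e\<in>Basis. L z e)"
      using e0 by (subst prod.remove[of Basis e0]) auto
    finally show ?thesis
      using p by (simp add: epow_mono epow_prod[symmetric] r_def)
  next
    case False
    then have "g z = 0" using g_outside[of z] by auto
    then show ?thesis by simp
  qed
  have pos: "0 < \<gamma> * n / (n - 1)" using \<gamma> n by simp
  have "ennreal (X (\<gamma> * n / (n - 1)))
      = (\<integral>\<^sup>+z. ennreal (g z powr (\<gamma> * n / (n - 1)) * rho z powr (-\<sigma> / 2)) \<partial>lborel)"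
    unfolding X_def by (intro nn_integral_eq_integral[symmetric] integrable_X pos) auto
  also have "\<dots> \<le> (\<integral>\<^sup>+z. (\<Prod>e\<in>Basis. epow (L z e) p) \<partial>lborel)"
    by (intro nn_integral_mono pointwise)
  also have "\<dots> \<le> epow (\<integral>\<^sup>+z. ennreal (k z) \<partial>lborel) (n / (n - 1))"
    using nn_integral_Gagliardo[of "\<lambda>z. ennreal (k z)"] borel_measurable_integrable[OF int_k] n
    by (simp add: L_def p_def n_def algebra_simps)
  also have "(\<integral>\<^sup>+z. ennreal (k z) \<partial>lborel) = ennreal (LINT z|lborel. k z)"
    using int_k k_nonneg by (intro nn_integral_eq_integral) auto
  also have "epow \<dots> (n / (n - 1)) = ennreal ((LINT z|lborel. k z) powr (n / (n - 1)))"
    using k_nonneg n by (intro epow_ennreal integral_nonneg_AE) auto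
  finally have "X (\<gamma> * n / (n - 1)) \<le> (LINT z|lborel. k z) powr (n / (n - 1))"
    by (subst (asm) ennreal_le_iff) auto
  then have "X (\<gamma> * n / (n - 1)) powr (2 * (n - 1) / n)
      \<le> ((LINT z|lborel. k z) powr (n / (n - 1))) powr (2 * (n - 1) / n)"
    using n X_nonneg by (intro powr_mono2) auto
  also have "\<dots> = (LINT z|lborel. k z)\<^sup>2"
  proof -
    have "0 \<le> (LINT z|lborel. k z)"
      using k_nonneg by (intro integral_nonneg_AE) auto
    moreover have "n / (n - 1) * (2 * (n - 1) / n) = 2"
      using n by (simp add: field_simps)
    ultimately show ?thesis by (simp only: powr_powr powr_numeral)
  qed
  also have "(LINT z|lborel. k z) = \<gamma> * (LINT z|lborel. (g z powr (\<gamma> - 1) * rho z powr (-\<sigma> / 4))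
      * (H z * rho z powr (-\<sigma> / 4)))"
  proof -
    have "rho z powr (-\<sigma> / 2) = rho z powr (-\<sigma> / 4) * rho z powr (-\<sigma> / 4)" for z
      by (simp add: powr_add[symmetric])
    then show ?thesis
      unfolding k_def by (simp add: mult_ac)
  qed
  also have "(\<dots>)\<^sup>2 \<le> \<gamma>\<^sup>2 * ((LINT z|lborel. (g z powr (\<gamma> - 1) * rho z powr (-\<sigma> / 4))\<^sup>2)
      * (LINT z|lborel. (H z * rho z powr (-\<sigma> / 4))\<^sup>2))"
    unfolding power_mult_distrib[of \<gamma>]
  proof (intro mult_left_mono Cauchy_Schwarz_integral integrable_H)
    show "integrable lborel (\<lambda>z. (g z powr (\<gamma> - 1) * rho z powr (-\<sigma> / 4))\<^sup>2)"
      unfolding power_mult_distrib powr_square using \<gamma> by (intro integrable_X) auto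
    show "(\<lambda>z. g z powr (\<gamma> - 1) * rho z powr (-\<sigma> / 4)) \<in> borel_measurable lborel"
      unfolding measurable_lborel2 using \<gamma>
      by (intro measurable_K continuous_intros) (auto simp: g_outside)
    show "(\<lambda>z. H z * rho z powr (-\<sigma> / 4)) \<in> borel_measurable lborel"
      unfolding measurable_lborel2
      by (intro measurable_K continuous_intros) (auto simp: H_def grad_outside ft_outside f_outside)
    show "integrable lborel (\<lambda>z. g z powr (\<gamma> - 1) * rho z powr (-\<sigma> / 4) * (H z * rho z powr (-\<sigma> / 4)))"
      using \<gamma> by (intro integrable_K continuous_intros) (auto simp: g_outside)
  qed (auto simp: H_nonneg)
  also have "(LINT z|lborel. (g z powr (\<gamma> - 1) * rho z powr (-\<sigma> / 4))\<^sup>2) = X (2 * (\<gamma> - 1))"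
    unfolding X_def power_mult_distrib powr_square by simp
  also have "\<gamma>\<^sup>2 * (X (2 * (\<gamma> - 1)) * (LINT z|lborel. (H z * rho z powr (-\<sigma> / 4))\<^sup>2))
      \<le> \<gamma>\<^sup>2 * (X (2 * (\<gamma> - 1)) * ((3 + 48 * \<beta>\<^sup>2) * E))"
    using H_bound X_nonneg by (intro mult_left_mono) auto
  finally show ?thesis
    by (simp add: mult_ac)
qed

section \<open>From the Sobolev step to the weighted inequality\<close>

text \<open>The inequality \<open>v\<^sup>Q \<le> v\<^sup>2 + v\<^sup>p\<close> for \<open>v = g / \<surd>e\<close>. Later \<open>e\<close> is a positive upper bound for the energy,
  for which both summands on the right are bounded by constants.\<close>
lemma X_interpolate:
  assumes Q: "2 \<le> Q" "Q \<le> p" and e: "0 < e"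
  shows "X Q \<le> e powr (Q / 2) * (X 2 / e + X p / e powr (p / 2))"
proof -
  have "X Q \<le> (LINT z|lborel. e powr (Q / 2) * (g z powr 2 * rho z powr (- \<sigma> / 2) / e
      + g z powr p * rho z powr (- \<sigma> / 2) / e powr (p / 2)))"
    unfolding X_def
  proof (rule integral_mono)
    show "integrable lborel (\<lambda>z. g z powr Q * rho z powr (- \<sigma> / 2))"
      using Q by (intro integrable_X) auto
    show "integrable lborel (\<lambda>z. e powr (Q / 2) * (g z powr 2 * rho z powr (- \<sigma> / 2) / e
      + g z powr p * rho z powr (- \<sigma> / 2) / e powr (p / 2)))"
      using Q by (intro integrable_mult_right Bochner_Integration.integrable_add integrable_divide_zero
        integrable_X) auto
    fix z
    define v where "v = g z / sqrt e"
    have v: "0 \<le> v" using e by (simp add: v_def g_nonneg)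
    have v_powr: "v powr a = g z powr a / e powr (a / 2)" for a
      using e by (simp add: v_def powr_divide g_nonneg powr_half_sqrt[symmetric] powr_powr)
    have "v powr Q \<le> v powr 2 + v powr p"
    proof (cases "v \<le> 1")
      case True
      then have "v powr Q \<le> v powr 2" using v Q by (intro powr_mono') auto
      then show ?thesis by (simp add: add_increasing2)
    next
      case False
      then have "v powr Q \<le> v powr p" using Q by (intro powr_mono) auto
      then show ?thesis by (simp add: add_increasing)
    qed
    then have "g z powr Q \<le> e powr (Q / 2) * (g z powr 2 / e + g z powr p / e powr (p / 2))"
      unfolding v_powr using e by (simp add: pos_divide_le_eq mult.commute)
    then have "g z powr Q * rho z powr (- \<sigma> / 2)
        \<le> e powr (Q / 2) * (g z powr 2 / e + g z powr p / e powr (p / 2)) * rho z powr (- \<sigma> / 2)"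
      by (rule mult_right_mono) simp
    then show "g z powr Q * rho z powr (- \<sigma> / 2)
        \<le> e powr (Q / 2) * (g z powr 2 * rho z powr (- \<sigma> / 2) / e
      + g z powr p * rho z powr (- \<sigma> / 2) / e powr (p / 2))"
      by (simp add: algebra_simps)
  qed
  also have "\<dots> = e powr (Q / 2) * (X 2 / e + X p / e powr (p / 2))"
    unfolding X_def using Q integrable_X[of 2 "- \<sigma> / 2"] integrable_X[of p "- \<sigma> / 2"] by simp
  finally show ?thesis .
qed

lemma integrable_weighted_power:
  "2 \<le> Q \<Longrightarrow> integrable lborel (\<lambda>z. rho z powr \<alpha> * \<bar>f z\<bar> powr Q)"
  by (intro integrable_K continuous_intros continuous_on_powr') (auto simp: f_outside)

text \<open>The step that uses \<open>w \<ge> 1\<close>: with \<open>r \<le> 1\<close> and \<open>\<beta> < 0\<close>, the exponent \<open>\<beta>Q - \<sigma>/2\<close> is at most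
  \<open>2\<beta> - \<sigma>/2 = \<alpha>\<close>.\<close>
lemma weighted_power_le_X:
  assumes Q: "2 \<le> Q"
  shows "(LINT z|lborel. rho z powr \<alpha> * \<bar>f z\<bar> powr Q) \<le> X Q"
  unfolding X_def
proof (rule integral_mono[OF integrable_weighted_power[OF Q] integrable_X])
  fix z
  show "rho z powr \<alpha> * \<bar>f z\<bar> powr Q \<le> g z powr Q * rho z powr (- \<sigma> / 2)"
  proof (cases "z \<in> K")
    case True
    have "\<beta> * Q \<le> \<beta> * 2"
      using \<beta>_neg Q by (intro mult_left_mono_neg) auto
    then have "\<beta> * Q - \<sigma> / 2 \<le> \<alpha>"
      by (simp add: \<beta>_def)
    then have "rho z powr \<alpha> \<le> rho z powr (\<beta> * Q - \<sigma> / 2)"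
      using rho_pos[OF True] rho_le_1[of z] by (intro powr_mono') auto
    also have "\<dots> = rho z powr (\<beta> * Q) * rho z powr (- \<sigma> / 2)"
      by (simp add: powr_add[symmetric])
    finally have "rho z powr \<alpha> * \<bar>f z\<bar> powr Q
        \<le> rho z powr (\<beta> * Q) * rho z powr (- \<sigma> / 2) * \<bar>f z\<bar> powr Q"
      by (rule mult_right_mono) simp
    then show ?thesis
      by (simp add: g_def powr_mult powr_powr mult_ac)
  qed (simp add: f_outside)
qed (use Q in auto)

text \<open>For \<open>N = 2\<close> the step with \<open>\<gamma> = k + 2\<close> leads from the exponent \<open>2(k + 1)\<close> to \<open>2(k + 2)\<close>, and both
  integrals enter to the first power.\<close>
lemma X_bound_dim_2:
  assumes dim: "DIM('b) = 1" and e: "0 < e" "E \<le> e"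
  shows "X (2 * real (k + 1)) \<le> 16 * (\<Prod>j<k. (real j + 2)\<^sup>2 * (3 + 48 * \<beta>\<^sup>2)) * e ^ (k + 1)"
proof (induction k)
  case 0
  show ?case using Poincare e by simp
next
  case (Suc k)
  define c where "c = 3 + 48 * \<beta>\<^sup>2"
  have c: "0 < c" by (simp add: c_def add_pos_nonneg)
  define \<gamma> where "\<gamma> = real k + 2"
  have "X (2 * \<gamma>) = X (\<gamma> * 2 / (2 - 1)) powr (2 * (2 - 1) / 2)"
    using X_nonneg by (simp add: mult.commute)
  also have "\<dots> \<le> \<gamma>\<^sup>2 * (c * E) * X (2 * (\<gamma> - 1))"
    using Sobolev_step[of \<gamma>] unfolding dim by (simp add: c_def \<gamma>_def)
  also have "\<dots> \<le> \<gamma>\<^sup>2 * (c * e) * (16 * (\<Prod>j<k. (real j + 2)\<^sup>2 * c) * e ^ (k + 1))"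
  proof (intro mult_mono mult_left_mono)
    show "X (2 * (\<gamma> - 1)) \<le> 16 * (\<Prod>j<k. (real j + 2)\<^sup>2 * c) * e ^ (k + 1)"
      using Suc by (simp add: \<gamma>_def c_def)
  qed (use e c X_nonneg E_nonneg in auto)
  also have "\<dots> = 16 * (\<Prod>j<Suc k. (real j + 2)\<^sup>2 * c) * e ^ (Suc k + 1)"
    by (simp add: \<gamma>_def mult_ac)
  finally show ?case
    by (simp add: \<gamma>_def c_def add_ac)
qed

text \<open>For \<open>N \<ge> 3\<close> and \<open>\<gamma> = 2(N - 1)/(N - 2)\<close> the same integral appears on both sides of the Sobolev step, with
  the larger power \<open>2(N - 1)/N > 1\<close> on the left; being finite, it can be cancelled.\<close>
lemma X_bound_critical:
  assumes dim: "DIM('b) \<noteq> 1" and e: "0 < e" "E \<le> e"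
  defines "n \<equiv> real DIM('b) + 1"
  shows "X (2 * n / (n - 2)) \<le>
    ((2 * (n - 1) / (n - 2))\<^sup>2 * (3 + 48 * \<beta>\<^sup>2)) powr (n / (n - 2)) * e powr (n / (n - 2))"
proof -
  have "DIM('b) \<ge> 2" using dim DIM_positive[where 'a='b] by linarith
  then have n: "3 \<le> n" by (simp add: n_def)
  define c where "c = 3 + 48 * \<beta>\<^sup>2"
  have c: "0 < c" by (simp add: c_def add_pos_nonneg)
  define \<gamma> where "\<gamma> = 2 * (n - 1) / (n - 2)"
  define p where "p = 2 * n / (n - 2)"
  have \<gamma>: "1 < \<gamma>" "\<gamma> * n / (n - 1) = p" "2 * (\<gamma> - 1) = p"
    using n by (simp_all add: \<gamma>_def p_def divide_simps)
  have bound: "X p powr (2 * (n - 1) / n) \<le> \<gamma>\<^sup>2 * (c * E) * X p"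
    using Sobolev_step[OF \<gamma>(1), folded n_def] unfolding \<gamma>(2,3) c_def by simp
  have rhs_nonneg: "0 \<le> (\<gamma>\<^sup>2 * c) powr (n / (n - 2)) * e powr (n / (n - 2))"
    by simp
  have "X p \<le> (\<gamma>\<^sup>2 * c) powr (n / (n - 2)) * e powr (n / (n - 2))"
  proof (cases "X p = 0")
    case False
    then have Xp: "0 < X p" using X_nonneg[of p] by simp
    have "2 * (n - 1) / n = (n - 2) / n + 1"
      using n by (simp add: field_simps)
    then have "X p powr ((n - 2) / n) * X p \<le> \<gamma>\<^sup>2 * (c * E) * X p"
      using bound Xp by (simp add: powr_add)
    then have "X p powr ((n - 2) / n) \<le> \<gamma>\<^sup>2 * (c * E)"
      using Xp by simp
    also have "\<dots> \<le> \<gamma>\<^sup>2 * c * e"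
      using e c by (simp add: mult.assoc mult_left_mono)
    finally have "(X p powr ((n - 2) / n)) powr (n / (n - 2)) \<le> (\<gamma>\<^sup>2 * c * e) powr (n / (n - 2))"
      using n by (intro powr_mono2) auto
    also have "(X p powr ((n - 2) / n)) powr (n / (n - 2)) = X p"
      using n Xp by (simp add: powr_powr)
    also have "(\<gamma>\<^sup>2 * c * e) powr (n / (n - 2)) = (\<gamma>\<^sup>2 * c) powr (n / (n - 2)) * e powr (n / (n - 2))"
      using c e by (simp add: powr_mult)
    finally show ?thesis .
  qed (use rhs_nonneg in simp)
  then show ?thesis
    by (simp add: p_def c_def \<gamma>_def)
qed

text \<open>The bound is proved for every \<open>e > E\<close> instead of \<open>E\<close>, since the interpolation divides by the
  energy; letting \<open>e\<close> tend to \<open>E\<close> also covers \<open>E = 0\<close>.\<close>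
theorem weighted_Sobolev:
  assumes Q: "2 \<le> Q" and N: "N = DIM('b) + 1"
    and upper: "N \<noteq> 2 \<Longrightarrow> Q \<le> 2 * real N / (real N - 2)"
  shows "(LINT z|lborel. rho z powr \<alpha> * \<bar>f z\<bar> powr Q) powr (2 / Q)
    \<le> (16 + Sobolev_const N (3 + 48 * \<beta>\<^sup>2) Q) powr (2 / Q) * E"
proof -
  define B where "B = Sobolev_const N (3 + 48 * \<beta>\<^sup>2) Q"
  have nN: "real DIM('b) + 1 = real N"
    by (simp add: N)
  have B: "0 \<le> B"
    by (simp add: B_def Sobolev_const_nonneg)
  have bound: "(LINT z|lborel. rho z powr \<alpha> * \<bar>f z\<bar> powr Q) powr (2 / Q) \<le> (16 + B) powr (2 / Q) * e"
    if e: "E < e" for e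
  proof -
    have e0: "0 < e" and Ee: "E \<le> e"
      using e E_nonneg by auto
    have "\<exists>p\<ge>Q. X p \<le> B * e powr (p / 2)"
    proof (cases "N = 2")
      case True
      define k where "k = nat \<lceil>Q\<rceil>"
      have "Q \<le> real k" unfolding k_def by linarith
      then have "Q \<le> 2 * real (k + 1)" using Q by simp
      moreover have "X (2 * real (k + 1)) \<le> B * e powr (2 * real (k + 1) / 2)"
        using X_bound_dim_2[OF _ e0 Ee, of k] True N e0
        by (simp add: B_def Sobolev_const_def k_def powr_realpow del: of_nat_Suc)
      ultimately show ?thesis by blast
    next
      case False
      show ?thesis
      proof (intro exI conjI)
        show "Q \<le> 2 * real N / (real N - 2)"
          using upper False by simp
        have "real N - 2 \<noteq> 0"
          using False N by auto
        then have "2 * real N / (real N - 2) / 2 = real N / (real N - 2)"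
          by (simp add: field_simps)
        moreover have "X (2 * real N / (real N - 2)) \<le> B * e powr (real N / (real N - 2))"
          using X_bound_critical[OF _ e0 Ee, unfolded nN] False N
          unfolding B_def Sobolev_const_def by simp
        ultimately show "X (2 * real N / (real N - 2)) \<le> B * e powr (2 * real N / (real N - 2) / 2)"
          by (simp only:)
      qed
    qed
    then obtain p where p: "Q \<le> p" "X p \<le> B * e powr (p / 2)" by blast
    have "(LINT z|lborel. rho z powr \<alpha> * \<bar>f z\<bar> powr Q) \<le> X Q"
      by (rule weighted_power_le_X[OF Q])
    also have "\<dots> \<le> e powr (Q / 2) * (X 2 / e + X p / e powr (p / 2))"
      by (rule X_interpolate[OF Q p(1) e0])
    also have "\<dots> \<le> e powr (Q / 2) * (16 + B)"
      using Poincare Ee e0 p(2)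
      by (intro mult_left_mono add_mono) (auto simp: pos_divide_le_eq)
    finally have "(LINT z|lborel. rho z powr \<alpha> * \<bar>f z\<bar> powr Q) powr (2 / Q)
        \<le> (e powr (Q / 2) * (16 + B)) powr (2 / Q)"
      using Q by (intro powr_mono2 integral_nonneg_AE) auto
    also have "\<dots> = (16 + B) powr (2 / Q) * e"
      using Q e0 B by (simp add: powr_mult powr_powr)
    finally show ?thesis .
  qed
  define A where "A = (16 + B) powr (2 / Q)"
  have A: "0 < A" using B by (simp add: A_def)
  have "(LINT z|lborel. rho z powr \<alpha> * \<bar>f z\<bar> powr Q) powr (2 / Q) / A \<le> E"
  proof (rule dense_ge)
    fix e assume "E < e"
    from bound[OF this] show "(LINT z|lborel. rho z powr \<alpha> * \<bar>f z\<bar> powr Q) powr (2 / Q) / A \<le> e"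
      using A by (simp only: A_def pos_divide_le_eq mult.commute)
  qed
  then show ?thesis
    using A unfolding A_def B_def by (simp only: pos_divide_le_eq mult.commute)
qed

section \<open>Partial derivatives of test functions\<close>

lemma GDERIV_fst: "GDERIV (\<lambda>y. f (y, t)) x :> (\<Sum>b\<in>Basis. D (x, t) (b, 0) *\<^sub>R b)"
proof -
  interpret lin: linear "D (x, t)"
    by (rule has_derivative_linear[OF deriv_f])
  have "((\<lambda>y. (y, t)) has_derivative (\<lambda>h. (h, 0))) (at x)"
    by (auto intro!: derivative_eq_intros)
  from has_derivative_compose[OF this deriv_f]
  have deriv: "((\<lambda>y. f (y, t)) has_derivative (\<lambda>h. D (x, t) (h, 0))) (at x)" .
  have "D (x, t) (h, 0) = h \<bullet> (\<Sum>b\<in>Basis. D (x, t) (b, 0) *\<^sub>R b)" for h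
  proof -
    have "(h, 0) = (\<Sum>b\<in>Basis. (h \<bullet> b) *\<^sub>R (b, 0::real))"
      by (simp add: prod_eq_iff fst_sum snd_sum euclidean_representation)
    then have "D (x, t) (h, 0) = (\<Sum>b\<in>Basis. (h \<bullet> b) * D (x, t) (b, 0))"
      by (simp only: lin.sum lin.scale real_scaleR_def)
    then show ?thesis
      by (simp add: inner_sum_right mult.commute)
  qed
  then have "(\<lambda>h. D (x, t) (h, 0)) = (\<lambda>h. h \<bullet> (\<Sum>b\<in>Basis. D (x, t) (b, 0) *\<^sub>R b))"
    by (rule ext)
  with deriv show ?thesis
    unfolding gderiv_def by (rule back_subst)
qed

lemma norm_gradient_fst: "norm (gradient (\<lambda>y. f (y, t)) x) = grad (x, t)"
proof -
  have "norm (\<Sum>b\<in>Basis. D (x, t) (b, 0) *\<^sub>R b) = grad (x, t)"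
    unfolding norm_eq_sqrt_inner grad_def
    by (subst euclidean_inner) (simp add: power2_eq_square)
  then show ?thesis
    by (simp add: gradient_eqI[OF GDERIV_fst])
qed

lemma deriv_snd_eq: "deriv (\<lambda>s. f (x, s)) t = f\<^sub>t (x, t)"
proof (rule DERIV_imp_deriv)
  have "(x, 0) + (s - 0) *\<^sub>R (0, 1) = (x, s)" for s :: real
    by simp
  with has_real_derivative_line[of "(x, 0)" 0 "(0, 1)" t]
  show "((\<lambda>s. f (x, s)) has_real_derivative f\<^sub>t (x, t)) (at t)"
    by (simp only: f\<^sub>t_def)
qed

end

text \<open>Compactness of the support yields the distance to the boundary of the cylinder.\<close>
lemma test_function_cylinder:
  fixes f :: "(real ^ 'n) \<times> real \<Rightarrow> real"
  assumes f: "f \<in> test_functions C1" and \<sigma>: "2 < \<sigma>" "\<sigma> < -2 * \<alpha>"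
  shows "\<exists>m. cylinder_function f (\<lambda>z. frechet_derivative f (at z)) m \<alpha> \<sigma>"
proof -
  define S where "S = closure {z. f z \<noteq> 0}"
  have Ck: "Ck_on k f UNIV" for k
    using f by (simp add: test_functions_def)
  have S: "compact S" "S \<subseteq> C1"
    using f by (auto simp: test_functions_def S_def)
  define q where "q z = max (norm (fst z)) \<bar>snd z\<bar>" for z :: "(real ^ 'n) \<times> real"
  have "\<exists>m>0. m < 1 \<and> (\<forall>z\<in>S. q z \<le> m)"
  proof (cases "S = {}")
    case False
    have "continuous_on S q"
      unfolding q_def by (intro continuous_intros)
    from continuous_attains_sup[OF S(1) False this]
    obtain w where w: "w \<in> S" "\<And>z. z \<in> S \<Longrightarrow> q z \<le> q w" by blast
    with S(2) have "q w < 1"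
      by (auto simp: C1_def q_def)
    with w(2) show ?thesis
      by (intro exI[of _ "max (q w) (1/2)"]) (auto simp: le_max_iff_disj)
  qed (auto intro!: exI[of _ "1/2"])
  then obtain m where m: "0 < m" "m < 1" "\<And>z. z \<in> S \<Longrightarrow> q z \<le> m" by blast
  have "cylinder_function f (\<lambda>z. frechet_derivative f (at z)) m \<alpha> \<sigma>"
  proof
    show "(f has_derivative frechet_derivative f (at z)) (at z)" for z
    proof -
      have "f differentiable (at z)" using Ck[of "Suc 0"] by (simp del: split_paired_All)
      then show ?thesis by (rule frechet_derivative_works[THEN iffD1])
    qed
    show "continuous_on UNIV (\<lambda>z. frechet_derivative f (at z) v)" for v
      using Ck[of "Suc 0"] by (simp del: split_paired_All)
    fix z assume "f z \<noteq> 0"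
    then have "z \<in> S"
      using closure_subset[of "{z. f z \<noteq> 0}"] by (auto simp: S_def)
    from m(3)[OF this] show "norm (fst z) \<le> m \<and> \<bar>snd z\<bar> \<le> m"
      by (simp add: q_def)
  qed (use m \<sigma> in auto)
  then show ?thesis ..
qed

section \<open>The weighted Sobolev inequality\<close>

theorem theorem1p3:
  fixes N :: nat and \<alpha> \<sigma> Q :: real
  assumes "N \<ge> 2" and "CARD('n::finite) = N - 1"
    and "\<alpha> < -1"
    and "\<sigma> \<in> {2<..<-2 * \<alpha>}"
    and "Q_cr N \<alpha> \<sigma> \<le> Q"
    and "N \<ge> 3 \<Longrightarrow> Q \<le> 2 * real N / (real N - 2)"
  shows "\<exists>C>0. \<forall>f \<in> test_functions (C1 :: ((real ^ 'n) \<times> real) set).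
    (LINT (x, t):C1|lborel. (1 - \<bar>t\<bar>) powr \<alpha> * \<bar>f (x, t)\<bar> powr Q) powr (2 / Q)
    \<le> C * (LINT (x, t):C1|lborel. (1 - \<bar>t\<bar>) powr \<alpha> *
        ((norm (grad_fst f (x, t)))\<^sup>2 + (1 - \<bar>t\<bar>) powr \<sigma> * \<bar>deriv_snd f (x, t)\<bar>\<^sup>2))"
proof -
  have \<sigma>: "2 < \<sigma>" "\<sigma> < -2 * \<alpha>"
    using assms(4) by auto
  define A where "A = (2 * \<alpha> + \<sigma>) / (2 - \<sigma>)"
  have A: "0 < A"
    unfolding A_def using \<sigma> by (intro divide_neg_neg) auto
  define d where "d = real N + A"
  have d: "2 < d" using A assms(1) by (simp add: d_def)
  have "2 \<le> Q_cr N \<alpha> \<sigma>"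
    unfolding Q_cr_def A_def[symmetric] d_def[symmetric] using d by (simp add: pos_le_divide_eq)
  with assms(5) have Q: "2 \<le> Q" by linarith
  have dim: "N = DIM(real ^ 'n) + 1"
    using assms(1,2) by simp
  define C where "C = (16 + Sobolev_const N (3 + 48 * (\<alpha> / 2 + \<sigma> / 4)\<^sup>2) Q) powr (2 / Q)"
  have "0 < C"
    using Sobolev_const_nonneg[of "3 + 48 * (\<alpha> / 2 + \<sigma> / 4)\<^sup>2" N Q] by (simp add: C_def)
  moreover have "(LINT (x, t):C1|lborel. (1 - \<bar>t\<bar>) powr \<alpha> * \<bar>f (x, t)\<bar> powr Q) powr (2 / Q)
    \<le> C * (LINT (x, t):C1|lborel. (1 - \<bar>t\<bar>) powr \<alpha> *
        ((norm (grad_fst f (x, t)))\<^sup>2 + (1 - \<bar>t\<bar>) powr \<sigma> * \<bar>deriv_snd f (x, t)\<bar>\<^sup>2))"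
    if f: "f \<in> test_functions (C1 :: ((real ^ 'n) \<times> real) set)" for f
  proof -
    from test_function_cylinder[OF f \<sigma>] obtain m
      where "cylinder_function f (\<lambda>z. frechet_derivative f (at z)) m \<alpha> \<sigma>" ..
    then interpret cylinder_function f "\<lambda>z. frechet_derivative f (at z)" m \<alpha> \<sigma> .
    have K_C1: "K \<subseteq> C1"
      using m by (auto simp: K_def C1_def)
    have lhs: "(LINT (x, t):C1|lborel. (1 - \<bar>t\<bar>) powr \<alpha> * \<bar>f (x, t)\<bar> powr Q)
        = (LINT z|lborel. rho z powr \<alpha> * \<bar>f z\<bar> powr Q)"
      unfolding set_lebesgue_integral_def
    proof (intro Bochner_Integration.integral_cong refl)
      fix z
      show "indicator C1 z *\<^sub>R (case z of (x, t) \<Rightarrow> (1 - \<bar>t\<bar>) powr \<alpha> * \<bar>f (x, t)\<bar> powr Q)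
          = rho z powr \<alpha> * \<bar>f z\<bar> powr Q"
        using K_C1 f_outside[of z] by (cases "z \<in> K"; cases z) (auto simp: rho_def indicator_def)
    qed
    have rhs: "(LINT (x, t):C1|lborel. (1 - \<bar>t\<bar>) powr \<alpha> *
        ((norm (grad_fst f (x, t)))\<^sup>2 + (1 - \<bar>t\<bar>) powr \<sigma> * \<bar>deriv_snd f (x, t)\<bar>\<^sup>2)) = E"
      unfolding set_lebesgue_integral_def E_def
    proof (intro Bochner_Integration.integral_cong refl)
      fix z
      show "indicator C1 z *\<^sub>R (case z of (x, t) \<Rightarrow> (1 - \<bar>t\<bar>) powr \<alpha> *
          ((norm (grad_fst f (x, t)))\<^sup>2 + (1 - \<bar>t\<bar>) powr \<sigma> * \<bar>deriv_snd f (x, t)\<bar>\<^sup>2))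
          = rho z powr \<alpha> * ((grad z)\<^sup>2 + rho z powr \<sigma> * \<bar>f\<^sub>t z\<bar>\<^sup>2)"
        using K_C1 grad_outside[of z] ft_outside[of z]
        by (cases "z \<in> K"; cases z)
           (auto simp: rho_def indicator_def grad_fst_def deriv_snd_def norm_gradient_fst deriv_snd_eq)
    qed
    show ?thesis
      unfolding lhs rhs C_def \<beta>_def[symmetric]
      using assms(1,6) by (intro weighted_Sobolev Q dim) auto
  qed
  ultimately show ?thesis by blast
qed

end
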